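(* There exists a group $G$ satisfying the following properties: (i) $P(G)<G$ (proper subgroup) and $P(G)\simeq G$; (ii) $G/P(G)\simeq G$. Moreover, $G$ can be chosen to be torsion-free, and it can also be chosen to be locally finite.
   Context: For a group $G$, the pseudocentre is $P(G)=\bigcap_{x\in G}C_G(x)^G$, where $C_G(x)$ is the centralizer of $x$ in $G$ and, for a subgroup $H\leq G$, $H^G$ is the normal closure of $H$ in $G$. A group is locally finite if all its finitely generated subgroups are finite. *)

theory Defs
  imports "HOL-Algebra.Algebra"
begin

definition centralizer :: "('a, 'b) monoid_scheme \<Rightarrow> 'a \<Rightarrow> 'a set" where
  "centralizer G x = {g \<in> carrier G. g \<otimes>\<^bsub>G\<^esub> x = x \<otimes>\<^bsub>G\<^esub> g}"

definition normal_closure :: "('a, 'b) monoid_scheme \<Rightarrow> 'a set \<Rightarrow> 'a set" where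
  "normal_closure G H = \<Inter>{N. N \<lhd> G \<and> H \<subseteq> N}"

definition pseudocentre :: "('a, 'b) monoid_scheme \<Rightarrow> 'a set" where
  "pseudocentre G = (\<Inter>x\<in>carrier G. normal_closure G (centralizer G x))"

definition torsion_free :: "('a, 'b) monoid_scheme \<Rightarrow> bool" where
  "torsion_free G \<longleftrightarrow>
    (\<forall>x\<in>carrier G. \<forall>n::nat. n > 0 \<longrightarrow> x [^]\<^bsub>G\<^esub> n = \<one>\<^bsub>G\<^esub> \<longrightarrow> x = \<one>\<^bsub>G\<^esub>)"

definition locally_finite :: "('a, 'b) monoid_scheme \<Rightarrow> bool" where
  "locally_finite G \<longleftrightarrow> (\<forall>S. finite S \<and> S \<subseteq> carrier G \<longrightarrow> finite (generate G S))"

lemma (in group) normal_Inter: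
  assumes "\<N> \<noteq> {}" "\<And>N. N \<in> \<N> \<Longrightarrow> N \<lhd> G"
  shows "\<Inter>\<N> \<lhd> G"
proof -
  have "subgroup (\<Inter>\<N>) G"
    using assms by (intro subgroups_Inter) (auto intro: normal_imp_subgroup)
  moreover have "x \<otimes> h \<otimes> inv x \<in> \<Inter>\<N>" if "x \<in> carrier G" "h \<in> \<Inter>\<N>" for x h
    using that assms(2) by (auto intro: normal.inv_op_closed2)
  ultimately show ?thesis
    by (simp add: normal_inv_iff)
qed

lemma (in group) normal_closure_normal:
  assumes "H \<subseteq> carrier G"
  shows "normal_closure G H \<lhd> G"
  unfolding normal_closure_def using assms normal_self by (intro normal_Inter) auto

text \<open>In particular the quotient \<open>G Mod pseudocentre G\<close> is a group.\<close>

lemma (in group) pseudocentre_normal: "pseudocentre G \<lhd> G"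
  unfolding pseudocentre_def
  by (rule normal_Inter) (auto simp: centralizer_def intro!: normal_closure_normal)

end

theory Submission
  imports Defs
begin

text \<open>If \<open>N\<close> is a nontrivial perfect group and \<open>Q\<close> is infinite, then the restricted wreath product
  \<open>W = N wr Q\<close> has \<open>P(W)\<close> equal to its base \<open>\<Oplus>\<^sub>Q N\<close> and hence \<open>W/P(W) = Q\<close>: a base element supported at one
  point has its centralizer inside the base; an element of the base commutes with a coordinate copy of
  \<open>N\<close> outside its support; and a normal subgroup containing an element outside the base contains the
  derived subgroup of a coordinate copy of \<open>N\<close>, that is, all of it. Perfectness, torsion-freeness
  and local finiteness pass from \<open>N\<close> and \<open>Q\<close> to \<open>W\<close>.

  Start with a countably infinite perfect group \<open>T\<close> with \<open>P(T) = T\<close>, close \<open>{T}\<close> under wreath products and let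
  \<open>G\<close> be the restricted direct sum of infinitely many copies of every group obtained. As \<open>P\<close> commutes
  with restricted direct sums, both \<open>P(G)\<close> and \<open>G/P(G)\<close> are again such sums, and every group of the
  family occurs infinitely often in them, as the bottom and as the top of a wreath product
  respectively.

  For \<open>T\<close> one takes the derived subgroup of a group of bijections with bounded supports in which every
  bounded set can be moved off itself: finitely supported permutations of the natural numbers in the
  locally finite case, order automorphisms of the rationals in the torsion-free case.\<close>

section \<open>Pseudocentres and isomorphisms\<close>

lemma (in group_hom) normal_vimage:
  assumes "M \<lhd> H"
  shows "{x \<in> carrier G. h x \<in> M} \<lhd> G"
proof -
  interpret M: normal M H by fact
  show ?thesis
    by (rule G.normal_invI, rule G.subgroupI) (auto simp: M.inv_op_closed2 intro: exI[of _ "\<one>\<^bsub>G\<^esub>"])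
qed

lemma (in group) mem_normal_closure:
  "y \<in> normal_closure G S \<longleftrightarrow> (\<forall>M. M \<lhd> G \<longrightarrow> S \<subseteq> M \<longrightarrow> y \<in> M)"
  by (auto simp: normal_closure_def)

text \<open>The two nested intersections collapse: the pseudocentre is the intersection of all
  normal subgroups that contain the centralizer of at least one element. Every pseudocentre below is
  computed by testing membership in such an \<open>M\<close>.\<close>

lemma (in group) mem_pseudocentre:
  "y \<in> pseudocentre G \<longleftrightarrow> (\<forall>x\<in>carrier G. \<forall>M. M \<lhd> G \<longrightarrow> centralizer G x \<subseteq> M \<longrightarrow> y \<in> M)"
  by (auto simp: pseudocentre_def mem_normal_closure)

lemma (in group) pseudocentre_subset: "pseudocentre G \<subseteq> carrier G"
  using pseudocentre_normal normal_imp_subgroup subgroup.subset by blast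

section \<open>Perfect groups\<close>

definition perfect :: "('a, 'b) monoid_scheme \<Rightarrow> bool" where
  "perfect G \<longleftrightarrow> derived G (carrier G) = carrier G"

text \<open>The derived subgroup is generated by the commutators, so a subgroup containing all of
  them contains it. This is how perfectness is exploited later.\<close>

lemma (in group) subgroup_perfect_eq:
  assumes "perfect G" "subgroup M G"
    and "\<And>x y. x \<in> carrier G \<Longrightarrow> y \<in> carrier G \<Longrightarrow> x \<otimes> y \<otimes> inv x \<otimes> inv y \<in> M"
  shows "M = carrier G"
proof -
  have "derived G (carrier G) \<subseteq> M"
    unfolding derived_def using assms(2,3) by (intro generate_subgroup_incl) auto
  with assms show ?thesis
    by (auto simp: perfect_def dest: subgroup.subset)
qed

text \<open>The derived subgroup is itself a normal subgroup containing all commutators, so it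
  suffices to treat an arbitrary such \<open>M\<close>.\<close>

lemma (in group) perfectI:
  assumes "\<And>M. M \<lhd> G \<Longrightarrow> (\<And>x y. x \<in> carrier G \<Longrightarrow> y \<in> carrier G \<Longrightarrow> x \<otimes> y \<otimes> inv x \<otimes> inv y \<in> M) \<Longrightarrow>
    carrier G \<subseteq> M"
  shows "perfect G"
proof -
  have "x \<otimes> y \<otimes> inv x \<otimes> inv y \<in> derived G (carrier G)" if "x \<in> carrier G" "y \<in> carrier G" for x y
    unfolding derived_def using that by (intro generate.incl) auto
  with assms[OF derived_self_is_normal] derived_in_carrier show ?thesis
    unfolding perfect_def by blast
qed

lemma torsion_free_subgroup:
  assumes "group G" "subgroup H G" "torsion_free G"
  shows "torsion_free (G\<lparr>carrier := H\<rparr>)"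
  using assms subgroup.subset[OF assms(2)] unfolding torsion_free_def
  by (auto simp: monoid.nat_pow_consistent[OF group.is_monoid, symmetric] subset_iff)

lemma locally_finite_subgroup:
  assumes "group G" "subgroup H G" "locally_finite G"
  shows "locally_finite (G\<lparr>carrier := H\<rparr>)"
  using assms subgroup.subset[OF assms(2)] unfolding locally_finite_def
  by (auto simp: group.generate_consistent)

section \<open>Invariance under isomorphisms\<close>

locale group_iso = group_hom +
  assumes iso: "h \<in> iso G H"
begin

lemma inj: "inj_on h (carrier G)" and img: "h ` carrier G = carrier H"
  using iso by (auto simp: Group.iso_iff)

lemma centralizer_image:
  assumes "x \<in> carrier G"
  shows "centralizer H (h x) = h ` centralizer G x"
proof
  show "h ` centralizer G x \<subseteq> centralizer H (h x)"
    using assms unfolding centralizer_def by (auto simp flip: hom_mult)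
  show "centralizer H (h x) \<subseteq> h ` centralizer G x"
  proof
    fix y assume y: "y \<in> centralizer H (h x)"
    then obtain g where g: "g \<in> carrier G" "y = h g"
      using img unfolding centralizer_def by blast
    have "h (g \<otimes> x) = h (x \<otimes> g)"
      using y g assms by (simp add: centralizer_def)
    then have "g \<otimes> x = x \<otimes> g"
      using inj g assms by (meson G.m_closed inj_onD)
    with g show "y \<in> h ` centralizer G x"
      by (auto simp: centralizer_def)
  qed
qed

text \<open>A test subgroup \<open>M\<close> of \<open>H\<close> pulls back along \<open>h\<close>
  to a test subgroup of \<open>G\<close>. The reverse inclusion comes from applying this to the
  inverse isomorphism.\<close>

lemma image_pseudocentre_subset: "h ` pseudocentre G \<subseteq> pseudocentre H"
proof
  fix z assume "z \<in> h ` pseudocentre G"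
  then obtain y where y: "y \<in> pseudocentre G" "z = h y" by blast
  show "z \<in> pseudocentre H"
    unfolding H.mem_pseudocentre
  proof (intro ballI allI impI)
    fix x M assume x: "x \<in> carrier H" and M: "M \<lhd> H" "centralizer H x \<subseteq> M"
    obtain g where g: "g \<in> carrier G" "x = h g" using img x by blast
    have "centralizer G g \<subseteq> {x \<in> carrier G. h x \<in> M}"
      using M(2) centralizer_image[OF g(1)] g(2) by (auto simp: centralizer_def)
    then have "y \<in> {x \<in> carrier G. h x \<in> M}"
      using y(1) g(1) normal_vimage[OF M(1)] unfolding G.mem_pseudocentre by blast
    then show "z \<in> M" using y(2) by simp
  qed
qed

lemma group_iso_inv: "group_iso H G (inv_into (carrier G) h)"
  using G.iso_set_sym[OF iso] G.is_group H.is_group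
  by (auto simp: group_iso_def group_iso_axioms_def group_hom_def group_hom_axioms_def Group.iso_iff)

lemma pseudocentre_image: "pseudocentre H = h ` pseudocentre G"
proof
  have "inv_into (carrier G) h ` pseudocentre H \<subseteq> pseudocentre G"
    using group_iso.image_pseudocentre_subset[OF group_iso_inv] .
  moreover have "y = h (inv_into (carrier G) h y)" if "y \<in> pseudocentre H" for y
    using that H.pseudocentre_subset img by (metis f_inv_into_f subsetD)
  ultimately show "pseudocentre H \<subseteq> h ` pseudocentre G" by blast
qed (rule image_pseudocentre_subset)

lemma perfect_image: "perfect G \<Longrightarrow> perfect H"
  using derived_img[of "carrier G"] img by (simp add: perfect_def)

lemma torsion_free_image:
  assumes "torsion_free G" shows "torsion_free H"
  unfolding torsion_free_def
proof (intro ballI allI impI)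
  fix x and n :: nat assume x: "x \<in> carrier H" "n > 0" "x [^]\<^bsub>H\<^esub> n = \<one>\<^bsub>H\<^esub>"
  then obtain g where g: "g \<in> carrier G" "x = h g" using img by blast
  then have "h (g [^] n) = h \<one>" using x by (simp add: hom_nat_pow)
  then have "g [^] n = \<one>" using inj g by (meson G.nat_pow_closed G.one_closed inj_onD)
  then have "g = \<one>" using assms g(1) x(2) unfolding torsion_free_def by blast
  then show "x = \<one>\<^bsub>H\<^esub>" using g(2) by simp
qed

lemma locally_finite_image:
  assumes "locally_finite G" shows "locally_finite H"
  unfolding locally_finite_def
proof (intro allI impI)
  fix S assume S: "finite S \<and> S \<subseteq> carrier H"
  then obtain S' where S': "finite S'" "S' \<subseteq> carrier G" "S = h ` S'"
    using img by (metis finite_subset_image)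
  then show "finite (generate H S)"
    using assms by (simp add: generate_img locally_finite_def)
qed

lemma infinite_image: "infinite (carrier G) \<Longrightarrow> infinite (carrier H)"
  using inj img by (metis finite_image_iff)

end

text \<open>Each wreath product changes the type of the elements. Copying countable groups onto
  natural numbers keeps all iterates in the single type \<open>nat monoid\<close>, so that recursion
  over them is possible.\<close>

lemma (in group) countable_group_iso_nat:
  assumes "countable (carrier G)"
  shows "\<exists>(H :: nat monoid) h. group_iso G H h"
proof -
  define e where "e = to_nat_on (carrier G)"
  define d where "d = from_nat_into (carrier G)"
  have de: "d (e x) = x" if "x \<in> carrier G" for x
    using that assms by (simp add: d_def e_def)
  define H where "H = \<lparr>carrier = e ` carrier G, monoid.mult = (\<lambda>x y. e (d x \<otimes> d y)), one = e \<one>\<rparr>"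
  have "e \<in> iso G H"
    unfolding iso_def hom_def bij_betw_def
    using assms by (auto simp: H_def de) (simp add: e_def inj_on_to_nat_on)
  moreover from this have "group H"
    using iso_imp_group[of H] iso_imp_img_group[of e H]
    by (auto simp: H_def)
  ultimately show ?thesis
    by (intro exI[of _ H] exI[of _ e])
      (auto simp: group_iso_def group_iso_axioms_def group_hom_def group_hom_axioms_def Group.iso_iff)
qed

section \<open>Displaceable groups\<close>

text \<open>The algebraic trace of moving a bounded set off itself: one element conjugates
  \<open>F\<close> to a set that commutes elementwise with \<open>F\<close>, because the supports
  have become disjoint.\<close>

definition displaceable :: "('a, 'b) monoid_scheme \<Rightarrow> bool" where
  "displaceable G \<longleftrightarrow> (\<forall>F. finite F \<and> F \<subseteq> carrier G \<longrightarrow>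
    (\<exists>h\<in>carrier G. \<forall>x\<in>F. \<forall>y\<in>F. (h \<otimes>\<^bsub>G\<^esub> x \<otimes>\<^bsub>G\<^esub> inv\<^bsub>G\<^esub> h) \<otimes>\<^bsub>G\<^esub> y = y \<otimes>\<^bsub>G\<^esub> (h \<otimes>\<^bsub>G\<^esub> x \<otimes>\<^bsub>G\<^esub> inv\<^bsub>G\<^esub> h)))"

context group
begin

lemma displaceableE:
  assumes "displaceable G" "finite F" "F \<subseteq> carrier G"
  obtains h where "h \<in> carrier G"
    "\<And>x y. x \<in> F \<Longrightarrow> y \<in> F \<Longrightarrow> (h \<otimes> x \<otimes> inv h) \<otimes> y = y \<otimes> (h \<otimes> x \<otimes> inv h)"
  using assms unfolding displaceable_def by meson

lemma commutator_mem_derived: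
  assumes "x \<in> H" "y \<in> H"
  shows "x \<otimes> y \<otimes> inv x \<otimes> inv y \<in> derived G H"
  unfolding derived_def using assms by (intro generate.incl) auto

lemma inv_mult_cancel:
  assumes "x \<in> carrier G" "y \<in> carrier G"
  shows "inv x \<otimes> (x \<otimes> y) = y" "x \<otimes> (inv x \<otimes> y) = y"
  using assms by (simp_all flip: m_assoc)

lemma commutator_eq:
  assumes "x \<in> carrier G" "y \<in> carrier G"
  shows "x \<otimes> y \<otimes> inv x \<otimes> inv y = (x \<otimes> y) \<otimes> inv (y \<otimes> x)"
  using assms by (simp add: inv_mult_group m_assoc)

lemma commute_inv:
  assumes "x \<in> carrier G" "y \<in> carrier G" "x \<otimes> y = y \<otimes> x"
  shows "inv x \<otimes> y = y \<otimes> inv x"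
  using assms by (metis inv_closed inv_solve_left inv_solve_right m_assoc m_closed)

text \<open>If the conjugate of \<open>h\<close> by \<open>k\<close> commutes with \<open>F\<close>, then conjugation by \<open>[h, k]\<close>
  has the same effect on \<open>F\<close> as conjugation by \<open>h\<close>.\<close>

lemma displaceable_derived:
  assumes D: "displaceable G" and F: "finite F" "F \<subseteq> carrier G"
  obtains g where "g \<in> derived G (carrier G)"
    "\<And>x y. x \<in> F \<Longrightarrow> y \<in> F \<Longrightarrow> (g \<otimes> x \<otimes> inv g) \<otimes> y = y \<otimes> (g \<otimes> x \<otimes> inv g)"
proof -
  obtain h where h: "h \<in> carrier G"
    "\<And>x y. x \<in> F \<Longrightarrow> y \<in> F \<Longrightarrow> (h \<otimes> x \<otimes> inv h) \<otimes> y = y \<otimes> (h \<otimes> x \<otimes> inv h)"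
    by (rule displaceableE[OF D F]) blast
  have "finite (insert h F)" "insert h F \<subseteq> carrier G" using F h(1) by auto
  then obtain k where k: "k \<in> carrier G" and kc:
    "\<And>x y. x \<in> insert h F \<Longrightarrow> y \<in> insert h F \<Longrightarrow> (k \<otimes> x \<otimes> inv k) \<otimes> y = y \<otimes> (k \<otimes> x \<otimes> inv k)"
    by (rule displaceableE[OF D]) blast
  define z where "z = inv (k \<otimes> h \<otimes> inv k)"
  have z: "z \<in> carrier G" using h(1) k by (simp add: z_def)
  have zx: "z \<otimes> x = x \<otimes> z" if "x \<in> F" for x
    unfolding z_def using kc[of h x] that h(1) k F by (intro commute_inv) auto
  show thesis
  proof
    have "h \<otimes> k \<otimes> inv h \<otimes> inv k = h \<otimes> z"
      using h(1) k by (simp add: z_def inv_mult_group m_assoc)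
    then show "h \<otimes> z \<in> derived G (carrier G)"
      using commutator_mem_derived[OF h(1) k] by simp
    have "(h \<otimes> z) \<otimes> x \<otimes> inv (h \<otimes> z) = h \<otimes> x \<otimes> inv h" if "x \<in> F" for x
    proof -
      have x: "x \<in> carrier G" using that F by blast
      have "(h \<otimes> z) \<otimes> x \<otimes> inv (h \<otimes> z) = h \<otimes> (z \<otimes> x) \<otimes> (inv z \<otimes> inv h)"
        using h(1) z x by (simp add: inv_mult_group m_assoc)
      also have "\<dots> = h \<otimes> x \<otimes> (z \<otimes> (inv z \<otimes> inv h))"
        using h(1) z x by (simp add: zx that m_assoc)
      also have "\<dots> = h \<otimes> x \<otimes> inv h"
        using h(1) z x by (simp flip: m_assoc)
      finally show ?thesis .
    qed
    then show "(h \<otimes> z \<otimes> x \<otimes> inv (h \<otimes> z)) \<otimes> y = y \<otimes> (h \<otimes> z \<otimes> x \<otimes> inv (h \<otimes> z))"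
      if "x \<in> F" "y \<in> F" for x y
      using h(2) that by simp
  qed
qed

text \<open>With \<open>s'\<close> and \<open>t'\<close> suitably displaced conjugates of \<open>s\<close> and \<open>t\<close>, the commutator \<open>[s, t]\<close> equals
  \<open>[s s'\<inverse>, t t'\<inverse>]\<close>, and both entries are themselves commutators.\<close>

lemma displaceable_commutator:
  assumes D: "displaceable G" and s: "s \<in> carrier G" and t: "t \<in> carrier G"
  shows "s \<otimes> t \<otimes> inv s \<otimes> inv t \<in> derived G (derived G (carrier G))"
proof -
  have 1: "finite {s, t}" "{s, t} \<subseteq> carrier G" using s t by auto
  obtain h where h: "h \<in> carrier G" and hc:
    "\<And>x y. x \<in> {s, t} \<Longrightarrow> y \<in> {s, t} \<Longrightarrow> (h \<otimes> x \<otimes> inv h) \<otimes> y = y \<otimes> (h \<otimes> x \<otimes> inv h)"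
    by (rule displaceableE[OF D 1]) blast
  define a where "a = inv (h \<otimes> s \<otimes> inv h)"
  have a: "a \<in> carrier G" using s h by (simp add: a_def)
  have at: "a \<otimes> t = t \<otimes> a"
    unfolding a_def using hc[of s t] h s t by (intro commute_inv) auto
  \<comment> \<open>With \<open>a\<close> in the set, \<open>b\<close> will commute with
    \<open>a\<close> as well as with \<open>s\<close>. The factor \<open>a b\<close> can then be
    collected at the right end of both \<open>u v\<close> and \<open>v u\<close>, where it cancels
    in the commutator.\<close>
  have 2: "finite {s, t, a}" "{s, t, a} \<subseteq> carrier G" using s t a by auto
  obtain k where k: "k \<in> carrier G" and kc:
    "\<And>x y. x \<in> {s, t, a} \<Longrightarrow> y \<in> {s, t, a} \<Longrightarrow> (k \<otimes> x \<otimes> inv k) \<otimes> y = y \<otimes> (k \<otimes> x \<otimes> inv k)"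
    by (rule displaceableE[OF D 2]) blast
  define b where "b = inv (k \<otimes> t \<otimes> inv k)"
  have b: "b \<in> carrier G" using t k by (simp add: b_def)
  have bs: "b \<otimes> s = s \<otimes> b" and ba: "b \<otimes> a = a \<otimes> b"
    unfolding b_def using kc[of t s] kc[of t a] k s t a by (intro commute_inv; auto)+
  define u where "u = s \<otimes> a"
  define v where "v = t \<otimes> b"
  have uv: "u \<in> carrier G" "v \<in> carrier G" using s t a b by (simp_all add: u_def v_def)
  have "u \<otimes> v = s \<otimes> (a \<otimes> t) \<otimes> b" using s t a b by (simp add: u_def v_def m_assoc)
  also have "\<dots> = s \<otimes> t \<otimes> (a \<otimes> b)" using s t a b by (simp add: at m_assoc)
  finally have 3: "u \<otimes> v = s \<otimes> t \<otimes> (a \<otimes> b)" .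
  have "v \<otimes> u = t \<otimes> (b \<otimes> s) \<otimes> a" using s t a b by (simp add: u_def v_def m_assoc)
  also have "\<dots> = t \<otimes> s \<otimes> (b \<otimes> a)" using s t a b by (simp add: bs m_assoc)
  also have "\<dots> = t \<otimes> s \<otimes> (a \<otimes> b)" by (simp add: ba)
  finally have 4: "v \<otimes> u = t \<otimes> s \<otimes> (a \<otimes> b)" .
  have "u \<otimes> v \<otimes> inv u \<otimes> inv v = s \<otimes> t \<otimes> (a \<otimes> b) \<otimes> inv (t \<otimes> s \<otimes> (a \<otimes> b))"
    using commutator_eq[OF uv] 3 4 by simp
  also have "\<dots> = s \<otimes> t \<otimes> ((a \<otimes> b) \<otimes> inv (a \<otimes> b)) \<otimes> inv (t \<otimes> s)"
    using s t a b by (simp add: inv_mult_group m_assoc)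
  also have "\<dots> = s \<otimes> t \<otimes> inv s \<otimes> inv t"
    using s t a b by (simp add: commutator_eq)
  finally have "u \<otimes> v \<otimes> inv u \<otimes> inv v = s \<otimes> t \<otimes> inv s \<otimes> inv t" .
  moreover have "u = s \<otimes> h \<otimes> inv s \<otimes> inv h" "v = t \<otimes> k \<otimes> inv t \<otimes> inv k"
    using s t h k by (simp_all add: u_def v_def a_def b_def inv_mult_group m_assoc)
  then have "u \<in> derived G (carrier G)" "v \<in> derived G (carrier G)"
    using commutator_mem_derived s t h k by auto
  ultimately show ?thesis
    using commutator_mem_derived[of u "derived G (carrier G)" v] by simp
qed

text \<open>Every generator of the derived subgroup already lies in the second derived subgroup by
  \<open>displaceable_commutator\<close>, so the two coincide.\<close>

lemma perfect_derived:
  assumes "displaceable G"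
  shows "perfect (G\<lparr>carrier := derived G (carrier G)\<rparr>)"
proof -
  have sub: "subgroup (derived G (carrier G)) G" by (simp add: derived_is_subgroup)
  have "derived G (carrier G) \<subseteq> derived G (derived G (carrier G))"
    unfolding derived_def[of G "carrier G"] using displaceable_commutator[OF assms]
    by (intro generate_subgroup_incl[of "derived_set G (carrier G)"] derived_is_subgroup generate_incl
        derived_set_in_carrier)
      (auto simp flip: derived_def[of G "carrier G"])
  moreover have "derived G (derived G (carrier G)) \<subseteq> derived G (carrier G)"
    by (rule mono_derived) (simp add: derived_in_carrier)
  ultimately show ?thesis
    unfolding perfect_def using derived_consistent[OF _ sub] by simp
qed

text \<open>Given \<open>x\<close> and \<open>y\<close> in \<open>T\<close>, displace
  \<open>y\<close> by some \<open>g\<close> so that its conjugate commutes with \<open>x\<close> and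
  hence lies in \<open>M\<close>; conjugating back gives \<open>y\<close>. Since \<open>M\<close> is
  normal only in \<open>T\<close>, the element \<open>g\<close> must come from \<open>T\<close>,
  which is what \<open>displaceable_derived\<close> provides.\<close>

lemma pseudocentre_derived:
  assumes D: "displaceable G"
  defines "T \<equiv> derived G (carrier G)"
  shows "pseudocentre (G\<lparr>carrier := T\<rparr>) = T"
proof -
  have sub: "subgroup T G" by (simp add: T_def derived_is_subgroup)
  interpret T: group "G\<lparr>carrier := T\<rparr>" using sub by (rule subgroup_imp_group)
  have inv_T: "inv\<^bsub>G\<lparr>carrier := T\<rparr>\<^esub> x = inv x" if "x \<in> T" for x
    using that by (simp add: m_inv_consistent[OF sub])
  note T_cl = subgroup.mem_carrier[OF sub] subgroup.m_closed[OF sub] subgroup.m_inv_closed[OF sub]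
  have "y \<in> pseudocentre (G\<lparr>carrier := T\<rparr>)" if y: "y \<in> T" for y
    unfolding T.mem_pseudocentre
  proof (intro ballI allI impI)
    fix x M assume "x \<in> carrier (G\<lparr>carrier := T\<rparr>)" and M: "M \<lhd> G\<lparr>carrier := T\<rparr>"
      "centralizer (G\<lparr>carrier := T\<rparr>) x \<subseteq> M"
    then have x: "x \<in> T" by simp
    have "finite {x, y}" "{x, y} \<subseteq> carrier G" using x y T_cl by auto
    then obtain g where g: "g \<in> T" and gc:
      "\<And>a b. a \<in> {x, y} \<Longrightarrow> b \<in> {x, y} \<Longrightarrow> (g \<otimes> a \<otimes> inv g) \<otimes> b = b \<otimes> (g \<otimes> a \<otimes> inv g)"
      unfolding T_def by (rule displaceable_derived[OF D]) blast
    have "g \<otimes> y \<otimes> inv g \<in> centralizer (G\<lparr>carrier := T\<rparr>) x"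
      using gc[of y x] g y by (simp add: centralizer_def T_cl)
    then have "g \<otimes> y \<otimes> inv g \<in> M" using M(2) by blast
    moreover have "inv g \<in> T" using g T_cl by blast
    ultimately have "inv g \<otimes> (g \<otimes> y \<otimes> inv g) \<otimes> inv\<^bsub>G\<lparr>carrier := T\<rparr>\<^esub> (inv g) \<in> M"
      using T.normal_invE(2)[OF M(1), of "inv g"] by simp
    also have "inv g \<otimes> (g \<otimes> y \<otimes> inv g) \<otimes> inv\<^bsub>G\<lparr>carrier := T\<rparr>\<^esub> (inv g) = y"
      using inv_T[OF \<open>inv g \<in> T\<close>] T_cl(1)[OF g] T_cl(1)[OF y] by (simp add: m_assoc inv_mult_cancel)
    finally show "y \<in> M" .
  qed
  then show ?thesis
    using T.pseudocentre_subset by auto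
qed

text \<open>A finite derived subgroup could be displaced from itself by one of its own elements and
  would be abelian. Then the second derived subgroup is trivial, although it contains every
  commutator of \<open>G\<close>, including the nontrivial one of \<open>a\<close> and
  \<open>b\<close>.\<close>

lemma infinite_derived:
  assumes D: "displaceable G" and ab: "a \<in> carrier G" "b \<in> carrier G" "a \<otimes> b \<noteq> b \<otimes> a"
  shows "infinite (derived G (carrier G))"
proof
  let ?T = "derived G (carrier G)"
  have sub: "subgroup ?T G" by (simp add: derived_is_subgroup)
  note T_cl = subgroup.mem_carrier[OF sub] subgroup.m_closed[OF sub] subgroup.m_inv_closed[OF sub]
  assume "finite ?T"
  then obtain g where g: "g \<in> ?T" and gc:
    "\<And>x y. x \<in> ?T \<Longrightarrow> y \<in> ?T \<Longrightarrow> (g \<otimes> x \<otimes> inv g) \<otimes> y = y \<otimes> (g \<otimes> x \<otimes> inv g)"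
    using derived_in_carrier by (elim displaceable_derived[OF D]) auto
  have comm: "x \<otimes> y = y \<otimes> x" if "x \<in> ?T" "y \<in> ?T" for x y
  proof -
    \<comment> \<open>As \<open>g\<close> normalizes the derived subgroup, every \<open>x\<close> in
      it is the conjugate by \<open>g\<close> of another of its elements.\<close>
    have "x \<in> carrier G" "g \<in> carrier G" using that g T_cl(1) by auto
    then have "g \<otimes> (inv g \<otimes> x \<otimes> g) \<otimes> inv g = x"
      by (simp add: m_assoc inv_mult_cancel)
    moreover have "inv g \<otimes> x \<otimes> g \<in> ?T" by (intro T_cl(2,3) that g)
    ultimately show ?thesis using gc[of "inv g \<otimes> x \<otimes> g" y] that by simp
  qed
  have "derived G ?T \<subseteq> {\<one>}"
    unfolding derived_def[of G ?T]
  proof (rule generate_subgroup_incl)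
    show "derived_set G ?T \<subseteq> {\<one>}"
    proof safe
      fix x y assume "x \<in> ?T" "y \<in> ?T"
      then show "x \<otimes> y \<otimes> inv x \<otimes> inv y = \<one>"
        using comm[of x y] T_cl(1)[of x] T_cl(1)[of y] by (subst commutator_eq) auto
    qed
  qed (rule triv_subgroup)
  then have "a \<otimes> b \<otimes> inv a \<otimes> inv b = \<one>"
    using displaceable_commutator[OF D ab(1,2)] by blast
  then have "a \<otimes> b \<otimes> inv (b \<otimes> a) = \<one>"
    using ab by (simp add: commutator_eq)
  then show False
    using ab by (metis inv_closed inv_equality inv_inv m_closed)
qed

end

section \<open>Restricted direct sums\<close>

text \<open>The embedding of the \<open>i\<close>-th summand. The restriction to \<open>I\<close> is
  there because elements of \<open>sum_group\<close> are extensional functions.\<close>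

definition single :: "'i set \<Rightarrow> ('i \<Rightarrow> ('a, 'b) monoid_scheme) \<Rightarrow> 'i \<Rightarrow> 'a \<Rightarrow> 'i \<Rightarrow> 'a" where
  "single I G i x = (\<lambda>j\<in>I. if j = i then x else \<one>\<^bsub>G j\<^esub>)"

locale group_family =
  fixes I :: "'i set" and G :: "'i \<Rightarrow> ('a, 'b) monoid_scheme"
  assumes grp: "i \<in> I \<Longrightarrow> group (G i)"
begin

sublocale S: group "sum_group I G"
  by (simp add: grp)

lemma mem_carrier:
  "f \<in> carrier (sum_group I G) \<longleftrightarrow>
    f \<in> extensional I \<and> (\<forall>i\<in>I. f i \<in> carrier (G i)) \<and> finite {i \<in> I. f i \<noteq> \<one>\<^bsub>G i\<^esub>}"
  by (auto simp: carrier_sum_group grp PiE_iff)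

lemma fam_one [simp]: "i \<in> I \<Longrightarrow> \<one>\<^bsub>G i\<^esub> \<in> carrier (G i)"
  using grp[of i] by (simp add: group.is_monoid)

lemma coord_closed: "f \<in> carrier (sum_group I G) \<Longrightarrow> i \<in> I \<Longrightarrow> f i \<in> carrier (G i)"
  by (simp add: mem_carrier)

lemma single_closed:
  assumes "i \<in> I" "x \<in> carrier (G i)" shows "single I G i x \<in> carrier (sum_group I G)"
proof -
  have "{j \<in> I. single I G i x j \<noteq> \<one>\<^bsub>G j\<^esub>} \<subseteq> {i}" by (auto simp: single_def)
  then have "finite {j \<in> I. single I G i x j \<noteq> \<one>\<^bsub>G j\<^esub>}" by (rule finite_subset) simp
  then show ?thesis using assms by (auto simp: mem_carrier) (auto simp: single_def)
qed

lemma single_hom: "i \<in> I \<Longrightarrow> group_hom (G i) (sum_group I G) (single I G i)"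
  using grp group.is_monoid[OF grp]
  by (auto simp: group_hom_def group_hom_axioms_def hom_def single_closed) (auto simp: single_def fun_eq_iff)

lemma coord_hom: "i \<in> I \<Longrightarrow> group_hom (sum_group I G) (G i) (\<lambda>f. f i)"
  using grp by (auto simp: group_hom_def group_hom_axioms_def hom_def coord_closed)

text \<open>By finiteness of the support, \<open>f\<close> is a finite product of its one-coordinate
  parts.\<close>

lemma mem_subgroup_if_singles:
  assumes M: "subgroup M (sum_group I G)" and f: "f \<in> carrier (sum_group I G)"
    and single: "\<And>i. i \<in> I \<Longrightarrow> single I G i (f i) \<in> M"
  shows "f \<in> M"
proof -
  \<comment> \<open>\<open>r S\<close> is \<open>f\<close> truncated to \<open>S\<close>; induction
    over finite \<open>S\<close> adds one coordinate at a time until \<open>S\<close> is the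
    support.\<close>
  define r where "r S = (\<lambda>j\<in>I. if j \<in> S then f j else \<one>\<^bsub>G j\<^esub>)" for S
  have "r S \<in> M" if "finite S" "S \<subseteq> I" for S
    using that
  proof (induction S)
    case empty
    have "r {} = \<one>\<^bsub>sum_group I G\<^esub>" by (auto simp: r_def)
    then show ?case using subgroup.one_closed[OF M] by (simp only:)
  next
    case (insert i S)
    have eq: "r (insert i S) = single I G i (f i) \<otimes>\<^bsub>sum_group I G\<^esub> r S"
      using insert.hyps insert.prems coord_closed[OF f] group.is_monoid[OF grp]
      by (auto simp: r_def single_def fun_eq_iff)
    show ?case
      unfolding eq using insert single by (intro subgroup.m_closed[OF M]) auto
  qed
  from this[of "{i \<in> I. f i \<noteq> \<one>\<^bsub>G i\<^esub>}"] f
  have "r {i \<in> I. f i \<noteq> \<one>\<^bsub>G i\<^esub>} \<in> M" by (simp add: mem_carrier)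
  also have "r {i \<in> I. f i \<noteq> \<one>\<^bsub>G i\<^esub>} = f"
    using f by (auto simp: r_def mem_carrier fun_eq_iff extensional_def)
  finally show ?thesis .
qed

lemma pow_coord:
  assumes "i \<in> I" "f \<in> carrier (sum_group I G)"
  shows "(f [^]\<^bsub>sum_group I G\<^esub> (n :: nat)) i = f i [^]\<^bsub>G i\<^esub> n"
  using group_hom.hom_nat_pow[OF coord_hom[OF assms(1)] assms(2)] .

lemma torsion_free_sum_group:
  assumes "\<And>i. i \<in> I \<Longrightarrow> torsion_free (G i)"
  shows "torsion_free (sum_group I G)"
  unfolding torsion_free_def
proof (intro ballI allI impI)
  fix f and n :: nat
  assume f: "f \<in> carrier (sum_group I G)" and n: "n > 0" "f [^]\<^bsub>sum_group I G\<^esub> n = \<one>\<^bsub>sum_group I G\<^esub>"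
  have "f i = \<one>\<^bsub>G i\<^esub>" if "i \<in> I" for i
  proof -
    have "f i [^]\<^bsub>G i\<^esub> n = \<one>\<^bsub>G i\<^esub>" using pow_coord[OF that f, of n] n that by simp
    then show ?thesis using assms[OF that] n coord_closed[OF f that] unfolding torsion_free_def by blast
  qed
  then show "f = \<one>\<^bsub>sum_group I G\<^esub>" using f by (auto simp: mem_carrier extensional_def)
qed

text \<open>Such functions are determined by their restrictions to the finite set \<open>A\<close>.
  This bounds generated subgroups both in direct sums and in wreath products.\<close>

lemma finite_box:
  assumes "finite A" "\<And>i. i \<in> A \<Longrightarrow> i \<in> I \<Longrightarrow> finite (B i)"
  shows "finite {f \<in> extensional I. \<forall>i\<in>I. (i \<in> A \<longrightarrow> f i \<in> B i) \<and> (i \<notin> A \<longrightarrow> f i = \<one>\<^bsub>G i\<^esub>)}"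
proof (rule finite_subset)
  show "{f \<in> extensional I. \<forall>i\<in>I. (i \<in> A \<longrightarrow> f i \<in> B i) \<and> (i \<notin> A \<longrightarrow> f i = \<one>\<^bsub>G i\<^esub>)} \<subseteq>
    (\<lambda>g. \<lambda>i\<in>I. if i \<in> A then g i else \<one>\<^bsub>G i\<^esub>) ` (\<Pi>\<^sub>E i\<in>A \<inter> I. B i)"
  proof
    fix f assume "f \<in> {f \<in> extensional I. \<forall>i\<in>I. (i \<in> A \<longrightarrow> f i \<in> B i) \<and> (i \<notin> A \<longrightarrow> f i = \<one>\<^bsub>G i\<^esub>)}"
    then have "f = (\<lambda>i\<in>I. if i \<in> A then restrict f (A \<inter> I) i else \<one>\<^bsub>G i\<^esub>)"
      "restrict f (A \<inter> I) \<in> (\<Pi>\<^sub>E i\<in>A \<inter> I. B i)"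
      by (auto simp: fun_eq_iff extensional_def)
    then show "f \<in> (\<lambda>g. \<lambda>i\<in>I. if i \<in> A then g i else \<one>\<^bsub>G i\<^esub>) ` (\<Pi>\<^sub>E i\<in>A \<inter> I. B i)"
      by blast
  qed
  show "finite ((\<lambda>g. \<lambda>i\<in>I. if i \<in> A then g i else \<one>\<^bsub>G i\<^esub>) ` (\<Pi>\<^sub>E i\<in>A \<inter> I. B i))"
    using assms by (intro finite_imageI finite_PiE) auto
qed

text \<open>The subgroup generated by \<open>S\<close> lives on the union \<open>A\<close> of the
  supports of its generators, and its \<open>i\<close>-th coordinates lie in the finite group
  generated by the \<open>i\<close>-th coordinates of \<open>S\<close>.\<close>

lemma locally_finite_sum_group:
  assumes "\<And>i. i \<in> I \<Longrightarrow> locally_finite (G i)"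
  shows "locally_finite (sum_group I G)"
  unfolding locally_finite_def
proof (intro allI impI)
  fix S assume S: "finite S \<and> S \<subseteq> carrier (sum_group I G)"
  define A where "A = (\<Union>f\<in>S. {i \<in> I. f i \<noteq> \<one>\<^bsub>G i\<^esub>})"
  define B where "B i = generate (G i) ((\<lambda>f. f i) ` S)" for i
  let ?K = "{f \<in> extensional I. \<forall>i\<in>I. (i \<in> A \<longrightarrow> f i \<in> B i) \<and> (i \<notin> A \<longrightarrow> f i = \<one>\<^bsub>G i\<^esub>)}"
  have "finite A" using S by (auto simp: A_def mem_carrier subset_iff)
  moreover have "finite (B i)" if "i \<in> I" for i
    using assms[OF that] S coord_closed that unfolding locally_finite_def B_def
    by (metis (no_types, lifting) finite_imageI image_subset_iff subset_iff)
  ultimately have fin: "finite ?K" by (rule finite_box)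
  have "f \<in> ?K" if "f \<in> generate (sum_group I G) S" for f
  proof -
    have car: "f \<in> carrier (sum_group I G)" using that S S.generate_in_carrier by blast
    have "f i \<in> B i" if "i \<in> I" for i
      using group_hom.generate_img[OF coord_hom[OF that], of S] S \<open>f \<in> generate _ S\<close>
      by (auto simp: B_def)
    moreover have "f i = \<one>\<^bsub>G i\<^esub>" if "i \<in> I" "i \<notin> A" for i
    proof -
      have "(\<lambda>f. f i) ` S \<subseteq> {\<one>\<^bsub>G i\<^esub>}" using that by (auto simp: A_def)
      then have "B i \<subseteq> {\<one>\<^bsub>G i\<^esub>}"
        unfolding B_def using grp[OF that(1)] by (intro group.generate_subgroup_incl group.triv_subgroup)
      then show ?thesis using \<open>i \<in> I \<Longrightarrow> f i \<in> B i\<close> that by blast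
    qed
    ultimately show ?thesis using car by (simp add: mem_carrier)
  qed
  then have "generate (sum_group I G) S \<subseteq> ?K" by blast
  then show "finite (generate (sum_group I G) S)" using fin by (rule finite_subset)
qed

text \<open>Both inclusions transport a test subgroup. An element centralizing
  \<open>single I G i x\<close> has its \<open>i\<close>-th coordinate in the centralizer of
  \<open>x\<close>, so \<open>M\<close> pulls back along the projection. Conversely the centralizer
  of \<open>x\<close> contains a copy of the centralizer of each \<open>x i\<close>, so
  \<open>M\<close> pulls back along the embedding.\<close>

lemma pseudocentre_sum_group:
  "pseudocentre (sum_group I G) =
    {f \<in> carrier (sum_group I G). \<forall>i\<in>I. f i \<in> pseudocentre (G i)}" (is "?P = ?Q")
proof
  show "?P \<subseteq> ?Q"
  proof
    fix f assume f: "f \<in> ?P"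
    have "f i \<in> pseudocentre (G i)" if i: "i \<in> I" for i
      unfolding group.mem_pseudocentre[OF grp[OF i]]
    proof (intro ballI allI impI)
      fix x M assume x: "x \<in> carrier (G i)" and M: "M \<lhd> G i" "centralizer (G i) x \<subseteq> M"
      have "centralizer (sum_group I G) (single I G i x) \<subseteq> {g \<in> carrier (sum_group I G). g i \<in> M}"
      proof
        fix g assume "g \<in> centralizer (sum_group I G) (single I G i x)"
        then have g: "g \<in> carrier (sum_group I G)"
          "g \<otimes>\<^bsub>sum_group I G\<^esub> single I G i x = single I G i x \<otimes>\<^bsub>sum_group I G\<^esub> g"
          by (auto simp: centralizer_def)
        have "g i \<otimes>\<^bsub>G i\<^esub> x = x \<otimes>\<^bsub>G i\<^esub> g i"
          using fun_cong[OF g(2), of i] i by (simp add: single_def)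
        then have "g i \<in> centralizer (G i) x"
          using coord_closed[OF g(1) i] by (simp add: centralizer_def)
        with g(1) M(2) show "g \<in> {g \<in> carrier (sum_group I G). g i \<in> M}" by blast
      qed
      then show "f i \<in> M"
        using f group_hom.normal_vimage[OF coord_hom[OF i] M(1)] single_closed[OF i x]
        unfolding S.mem_pseudocentre by blast
    qed
    then show "f \<in> ?Q" using f S.pseudocentre_subset by auto
  qed
  show "?Q \<subseteq> ?P"
  proof
    fix f assume f: "f \<in> ?Q"
    show "f \<in> ?P"
      unfolding S.mem_pseudocentre
    proof (intro ballI allI impI)
      fix x M assume x: "x \<in> carrier (sum_group I G)"
        and M: "M \<lhd> sum_group I G" "centralizer (sum_group I G) x \<subseteq> M"
      have "single I G i (f i) \<in> M" if i: "i \<in> I" for i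
      proof -
        have "single I G i y \<in> centralizer (sum_group I G) x" if y: "y \<in> centralizer (G i) (x i)" for y
          using y single_closed[OF i, of y] coord_closed[OF x] group.is_monoid[OF grp]
          by (auto simp: centralizer_def) (auto simp: single_def fun_eq_iff)
        then have "centralizer (G i) (x i) \<subseteq> {y \<in> carrier (G i). single I G i y \<in> M}"
          using M(2) by (auto simp: centralizer_def)
        moreover have "f i \<in> pseudocentre (G i)" using f i by blast
        ultimately have "f i \<in> {y \<in> carrier (G i). single I G i y \<in> M}"
          using group_hom.normal_vimage[OF single_hom[OF i] M(1)] coord_closed[OF x i]
          unfolding group.mem_pseudocentre[OF grp[OF i]] by blast
        then show ?thesis by blast
      qed
      then show "f \<in> M"
        using f by (auto intro: mem_subgroup_if_singles[OF normal_imp_subgroup[OF M(1)], of f])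
    qed
  qed
qed

text \<open>An equality and not merely an isomorphism, since multiplication and unit of
  \<open>sum_group\<close> do not depend on the carriers of the summands.\<close>

lemma sum_group_pseudocentre_eq:
  "(sum_group I G)\<lparr>carrier := pseudocentre (sum_group I G)\<rparr> =
    sum_group I (\<lambda>i. (G i)\<lparr>carrier := pseudocentre (G i)\<rparr>)"
proof -
  have sub: "subgroup (pseudocentre (G i)) (G i)" if "i \<in> I" for i
    using group.pseudocentre_normal[OF grp[OF that]] by (rule normal_imp_subgroup)
  interpret P: group_family I "\<lambda>i. (G i)\<lparr>carrier := pseudocentre (G i)\<rparr>"
    by (rule group_family.intro) (use sub group.subgroup_imp_group[OF grp] in auto)
  have "carrier (sum_group I (\<lambda>i. (G i)\<lparr>carrier := pseudocentre (G i)\<rparr>)) = pseudocentre (sum_group I G)"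
    using subgroup.mem_carrier[OF sub] by (auto simp: pseudocentre_sum_group mem_carrier P.mem_carrier)
  then show ?thesis
    by (intro monoid.equality) auto
qed

text \<open>The maps \<open>\<phi> i\<close> combine coordinatewise into a surjection whose kernel
  is the pseudocentre of the sum; coordinates outside \<open>J\<close> are dropped, as they lie in
  the pseudocentre anyway.\<close>

lemma sum_group_Mod_pseudocentre:
  assumes J: "J \<subseteq> I" and K: "\<And>i. i \<in> J \<Longrightarrow> group (K i)"
    and hom: "\<And>i. i \<in> J \<Longrightarrow> \<phi> i \<in> hom (G i) (K i)"
    and surj: "\<And>i. i \<in> J \<Longrightarrow> \<phi> i ` carrier (G i) = carrier (K i)"
    and ker: "\<And>i. i \<in> J \<Longrightarrow> kernel (G i) (K i) (\<phi> i) = pseudocentre (G i)"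
    and triv: "\<And>i. i \<in> I - J \<Longrightarrow> pseudocentre (G i) = carrier (G i)"
  shows "sum_group I G Mod pseudocentre (sum_group I G) \<cong> sum_group J K"
proof -
  interpret K: group_family J K by (rule group_family.intro) (rule K)
  define h where "h f = (\<lambda>i\<in>J. \<phi> i (f i))" for f :: "'i \<Rightarrow> 'a"
  have one: "\<phi> i \<one>\<^bsub>G i\<^esub> = \<one>\<^bsub>K i\<^esub>" if "i \<in> J" for i
    using hom_one[OF hom[OF that]] grp K J that by blast
  have closed: "h f \<in> carrier (sum_group J K)" if "f \<in> carrier (sum_group I G)" for f
  proof -
    have "{i \<in> J. h f i \<noteq> \<one>\<^bsub>K i\<^esub>} \<subseteq> {i \<in> I. f i \<noteq> \<one>\<^bsub>G i\<^esub>}"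
      using J one by (auto simp: h_def)
    then have "finite {i \<in> J. h f i \<noteq> \<one>\<^bsub>K i\<^esub>}"
      using that by (auto simp: mem_carrier intro: finite_subset)
    moreover have "\<phi> i (f i) \<in> carrier (K i)" if "i \<in> J" for i
      using hom_in_carrier[OF hom[OF that]] coord_closed[OF \<open>f \<in> _\<close>] J that by blast
    ultimately show ?thesis
      by (auto simp: K.mem_carrier) (auto simp: h_def)
  qed
  have "h \<in> hom (sum_group I G) (sum_group J K)"
    using closed J hom by (auto simp: hom_def) (auto simp: h_def fun_eq_iff mem_carrier subset_iff)
  then interpret h: group_hom "sum_group I G" "sum_group J K" h
    by unfold_locales
  have "g \<in> h ` carrier (sum_group I G)" if g: "g \<in> carrier (sum_group J K)" for g
  proof -
    \<comment> \<open>The unit is chosen as the preimage of the unit; otherwise the lifted function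
      could have infinite support.\<close>
    have "\<exists>x\<in>carrier (G i). \<phi> i x = g i \<and> (g i = \<one>\<^bsub>K i\<^esub> \<longrightarrow> x = \<one>\<^bsub>G i\<^esub>)" if i: "i \<in> J" for i
    proof (cases "g i = \<one>\<^bsub>K i\<^esub>")
      case True
      then show ?thesis using one[OF i] fam_one[of i] J i by (intro bexI[of _ "\<one>\<^bsub>G i\<^esub>"]) auto
    next
      case False
      then show ?thesis using surj[OF i] K.coord_closed[OF g i] by (metis imageE)
    qed
    then obtain x where x: "\<And>i. i \<in> J \<Longrightarrow> x i \<in> carrier (G i)" "\<And>i. i \<in> J \<Longrightarrow> \<phi> i (x i) = g i"
      "\<And>i. i \<in> J \<Longrightarrow> g i = \<one>\<^bsub>K i\<^esub> \<Longrightarrow> x i = \<one>\<^bsub>G i\<^esub>" by metis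
    define f where "f = (\<lambda>i\<in>I. if i \<in> J then x i else \<one>\<^bsub>G i\<^esub>)"
    have "{i \<in> I. f i \<noteq> \<one>\<^bsub>G i\<^esub>} \<subseteq> {i \<in> J. g i \<noteq> \<one>\<^bsub>K i\<^esub>}"
      using x(3) by (auto simp: f_def)
    then have "finite {i \<in> I. f i \<noteq> \<one>\<^bsub>G i\<^esub>}"
      using g by (auto simp: K.mem_carrier intro: finite_subset)
    then have "f \<in> carrier (sum_group I G)"
      using x(1) by (auto simp: mem_carrier) (auto simp: f_def)
    moreover have "h f = g"
      using g x(2) J by (auto simp: h_def f_def fun_eq_iff K.mem_carrier extensional_def)
    ultimately show ?thesis by blast
  qed
  then have "h ` carrier (sum_group I G) = carrier (sum_group J K)" using closed by blast
  moreover have "kernel (sum_group I G) (sum_group J K) h = pseudocentre (sum_group I G)"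
  proof -
    have "h f = \<one>\<^bsub>sum_group J K\<^esub> \<longleftrightarrow> (\<forall>i\<in>I. f i \<in> pseudocentre (G i))"
      if f: "f \<in> carrier (sum_group I G)" for f
    proof -
      have "h f = \<one>\<^bsub>sum_group J K\<^esub> \<longleftrightarrow> (\<forall>i\<in>J. \<phi> i (f i) = \<one>\<^bsub>K i\<^esub>)"
        by (auto simp: h_def fun_eq_iff)
      also have "\<dots> \<longleftrightarrow> (\<forall>i\<in>J. f i \<in> pseudocentre (G i))"
        using coord_closed[OF f] J by (auto simp: kernel_def simp flip: ker)
      also have "\<dots> \<longleftrightarrow> (\<forall>i\<in>I. f i \<in> pseudocentre (G i))"
        using coord_closed[OF f] J triv by blast
      finally show ?thesis .
    qed
    then show ?thesis by (auto simp: kernel_def pseudocentre_sum_group)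
  qed
  ultimately show ?thesis using h.FactGroup_iso by simp
qed

end

section \<open>Re-indexing and flattening direct sums\<close>

lemma sum_group_reindex:
  assumes \<pi>: "bij_betw \<pi> I J" and K: "\<And>j. j \<in> J \<Longrightarrow> group (K j)"
  shows "sum_group I (\<lambda>i. K (\<pi> i)) \<cong> sum_group J K"
proof -
  interpret J: group_family J K by (rule group_family.intro) (rule K)
  interpret I: group_family I "\<lambda>i. K (\<pi> i)"
    by (rule group_family.intro) (use K \<pi> in \<open>auto simp: bij_betw_def\<close>)
  define h where "h f = (\<lambda>i\<in>I. f (\<pi> i))" for f :: "'b \<Rightarrow> 'c"
  have mem: "\<pi> i \<in> J" if "i \<in> I" for i using \<pi> that by (auto simp: bij_betw_def)
  have closed: "h f \<in> carrier (sum_group I (\<lambda>i. K (\<pi> i)))" if f: "f \<in> carrier (sum_group J K)" for f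
  proof -
    have eq: "{i \<in> I. h f i \<noteq> \<one>\<^bsub>K (\<pi> i)\<^esub>} = \<pi> -` {j \<in> J. f j \<noteq> \<one>\<^bsub>K j\<^esub>} \<inter> I"
      using mem by (auto simp: h_def)
    then have "finite {i \<in> I. h f i \<noteq> \<one>\<^bsub>K (\<pi> i)\<^esub>}"
      unfolding eq using f \<pi> by (intro finite_vimage_IntI) (auto simp: J.mem_carrier bij_betw_def)
    then show ?thesis
      using f mem by (auto simp: J.mem_carrier I.mem_carrier) (auto simp: h_def)
  qed
  have "h \<in> hom (sum_group J K) (sum_group I (\<lambda>i. K (\<pi> i)))"
    using closed mem by (auto simp: hom_def) (auto simp: h_def fun_eq_iff)
  moreover have "inj_on h (carrier (sum_group J K))"
  proof (rule inj_onI)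
    fix f g assume fg: "f \<in> carrier (sum_group J K)" "g \<in> carrier (sum_group J K)" "h f = h g"
    show "f = g"
    proof (rule extensionalityI[of _ J])
      fix j assume "j \<in> J"
      then obtain i where "i \<in> I" "j = \<pi> i" using \<pi> by (auto simp: bij_betw_def)
      then show "f j = g j" using fun_cong[OF fg(3), of i] by (simp add: h_def)
    qed (use fg in \<open>auto simp: J.mem_carrier\<close>)
  qed
  moreover have "g \<in> h ` carrier (sum_group J K)" if g: "g \<in> carrier (sum_group I (\<lambda>i. K (\<pi> i)))" for g
  proof
    let ?\<rho> = "inv_into I \<pi>"
    have \<rho>: "?\<rho> j \<in> I" "\<pi> (?\<rho> j) = j" if "j \<in> J" for j
      using \<pi> that by (auto simp: bij_betw_def inv_into_into f_inv_into_f)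
    let ?f = "\<lambda>j\<in>J. g (?\<rho> j)"
    show "g = h ?f"
      using g mem \<pi> by (auto simp: h_def I.mem_carrier fun_eq_iff extensional_def bij_betw_def)
    have "{j \<in> J. ?f j \<noteq> \<one>\<^bsub>K j\<^esub>} \<subseteq> \<pi> ` {i \<in> I. g i \<noteq> \<one>\<^bsub>K (\<pi> i)\<^esub>}"
      using \<rho> by force
    then have "finite {j \<in> J. ?f j \<noteq> \<one>\<^bsub>K j\<^esub>}"
      by (rule finite_subset) (use g in \<open>auto simp: I.mem_carrier\<close>)
    moreover have "?f j \<in> carrier (K j)" if "j \<in> J" for j
      using I.coord_closed[OF g \<rho>(1)[OF that]] \<rho>(2)[OF that] that by simp
    ultimately show "?f \<in> carrier (sum_group J K)"
      by (simp add: J.mem_carrier)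
  qed
  ultimately have "h \<in> iso (sum_group J K) (sum_group I (\<lambda>i. K (\<pi> i)))"
    using closed by (auto simp: Group.iso_iff)
  then show ?thesis
    using J.S.iso_sym is_isoI by blast
qed

text \<open>Currying: a function on the disjoint union has finite support exactly if finitely many
  of its slices are nontrivial and each slice has finite support.\<close>

lemma sum_group_Sigma:
  assumes K: "\<And>i j. i \<in> I \<Longrightarrow> j \<in> J i \<Longrightarrow> group (K i j)"
  shows "sum_group I (\<lambda>i. sum_group (J i) (K i)) \<cong> sum_group (Sigma I J) (\<lambda>(i, j). K i j)"
proof -
  interpret A: group_family "Sigma I J" "\<lambda>(i, j). K i j" by (rule group_family.intro) (use K in auto)
  have C: "group_family (J i) (K i)" if "i \<in> I" for i by (rule group_family.intro) (use K that in auto)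
  interpret B: group_family I "\<lambda>i. sum_group (J i) (K i)" by (rule group_family.intro) (use K in auto)
  define h where "h f = (\<lambda>i\<in>I. \<lambda>j\<in>J i. f (i, j))" for f :: "'a \<times> 'b \<Rightarrow> 'c"
  let ?A = "sum_group (Sigma I J) (\<lambda>(i, j). K i j)" and ?B = "sum_group I (\<lambda>i. sum_group (J i) (K i))"
  have closed: "h f \<in> carrier ?B" if f: "f \<in> carrier ?A" for f
  proof -
    let ?F = "{p \<in> Sigma I J. f p \<noteq> \<one>\<^bsub>(case p of (i, j) \<Rightarrow> K i j)\<^esub>}"
    have fin: "finite ?F" using f by (simp add: A.mem_carrier)
    have "i \<in> fst ` ?F" if "i \<in> I" "h f i \<noteq> \<one>\<^bsub>sum_group (J i) (K i)\<^esub>" for i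
    proof -
      have "\<exists>j\<in>J i. f (i, j) \<noteq> \<one>\<^bsub>K i j\<^esub>"
      proof (rule ccontr)
        assume "\<not> ?thesis"
        then have "h f i = \<one>\<^bsub>sum_group (J i) (K i)\<^esub>"
          using that(1) by (auto simp: h_def)
        with that(2) show False by blast
      qed
      then obtain j where "j \<in> J i" "f (i, j) \<noteq> \<one>\<^bsub>K i j\<^esub>" by blast
      then have "(i, j) \<in> ?F" using that by simp
      then show ?thesis by force
    qed
    then have "{i \<in> I. h f i \<noteq> \<one>\<^bsub>sum_group (J i) (K i)\<^esub>} \<subseteq> fst ` ?F" by blast
    then have 1: "finite {i \<in> I. h f i \<noteq> \<one>\<^bsub>sum_group (J i) (K i)\<^esub>}"
      using fin finite_subset by blast
    have "h f i \<in> carrier (sum_group (J i) (K i))" if i: "i \<in> I" for i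
    proof -
      have "{j \<in> J i. h f i j \<noteq> \<one>\<^bsub>K i j\<^esub>} \<subseteq> snd ` ?F" using i by (force simp: h_def)
      then have "finite {j \<in> J i. h f i j \<noteq> \<one>\<^bsub>K i j\<^esub>}" using fin finite_subset by blast
      then show ?thesis
        using f i by (auto simp: A.mem_carrier group_family.mem_carrier[OF C[OF i]]) (auto simp: h_def)
    qed
    then show ?thesis using 1 by (auto simp: B.mem_carrier) (auto simp: h_def)
  qed
  have "h \<in> hom ?A ?B"
    using closed by (auto simp: hom_def) (auto simp: h_def fun_eq_iff)
  moreover have "inj_on h (carrier ?A)"
  proof (rule inj_onI)
    fix f g assume fg: "f \<in> carrier ?A" "g \<in> carrier ?A" "h f = h g"
    show "f = g"
    proof (rule extensionalityI[of _ "Sigma I J"])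
      fix p assume "p \<in> Sigma I J"
      then obtain i j where p: "p = (i, j)" "i \<in> I" "j \<in> J i" by blast
      have "h f i j = h g i j" using fg(3) by simp
      then show "f p = g p" using p by (simp add: h_def)
    qed (use fg in \<open>auto simp: A.mem_carrier\<close>)
  qed
  moreover have "g \<in> h ` carrier ?A" if g: "g \<in> carrier ?B" for g
  proof
    let ?f = "\<lambda>p\<in>Sigma I J. g (fst p) (snd p)"
    have gi: "g i \<in> extensional (J i)" "\<And>j. j \<in> J i \<Longrightarrow> g i j \<in> carrier (K i j)"
      "finite {j \<in> J i. g i j \<noteq> \<one>\<^bsub>K i j\<^esub>}" if "i \<in> I" for i
      using B.coord_closed[OF g that] group_family.mem_carrier[OF C[OF that]] by auto
    show "g = h ?f"
    proof (rule extensionalityI[of _ I])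
      fix i assume i: "i \<in> I"
      show "g i = h ?f i"
        by (rule extensionalityI[of _ "J i"]) (use gi(1)[OF i] i in \<open>auto simp: h_def\<close>)
    qed (use g in \<open>auto simp: B.mem_carrier h_def\<close>)
    let ?F = "{i \<in> I. g i \<noteq> \<one>\<^bsub>sum_group (J i) (K i)\<^esub>}"
    have "{p \<in> Sigma I J. ?f p \<noteq> \<one>\<^bsub>(case p of (i, j) \<Rightarrow> K i j)\<^esub>} \<subseteq>
      Sigma ?F (\<lambda>i. {j \<in> J i. g i j \<noteq> \<one>\<^bsub>K i j\<^esub>})"
      by auto
    moreover have "finite (Sigma ?F (\<lambda>i. {j \<in> J i. g i j \<noteq> \<one>\<^bsub>K i j\<^esub>}))"
      using g gi(3) by (intro finite_SigmaI) (auto simp: B.mem_carrier)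
    ultimately have "finite {p \<in> Sigma I J. ?f p \<noteq> \<one>\<^bsub>(case p of (i, j) \<Rightarrow> K i j)\<^esub>}"
      by (rule finite_subset)
    then show "?f \<in> carrier ?A" using gi(2) by (auto simp: A.mem_carrier)
  qed
  ultimately have "h \<in> iso ?A ?B"
    using closed by (auto simp: Group.iso_iff)
  then show ?thesis
    using A.S.iso_sym is_isoI by blast
qed

lemma sum_group_singleton:
  assumes "group G" shows "G \<cong> sum_group {i} (\<lambda>_. G)"
proof -
  interpret S: group_family "{i}" "\<lambda>_. G" by (rule group_family.intro) (rule assms)
  interpret h: group_hom G "sum_group {i} (\<lambda>_. G)" "single {i} (\<lambda>_. G) i"
    by (rule S.single_hom) simp
  have "single {i} (\<lambda>_. G) i \<in> iso G (sum_group {i} (\<lambda>_. G))"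
    unfolding Group.iso_iff
  proof (intro conjI)
    show "single {i} (\<lambda>_. G) i ` carrier G = carrier (sum_group {i} (\<lambda>_. G))"
    proof
      show "carrier (sum_group {i} (\<lambda>_. G)) \<subseteq> single {i} (\<lambda>_. G) i ` carrier G"
      proof
        fix f assume "f \<in> carrier (sum_group {i} (\<lambda>_. G))"
        then have "f = single {i} (\<lambda>_. G) i (f i)" "f i \<in> carrier G"
          by (auto simp: S.mem_carrier single_def fun_eq_iff extensional_def)
        then show "f \<in> single {i} (\<lambda>_. G) i ` carrier G" by blast
      qed
    qed (use h.hom_closed in blast)
    show "inj_on (single {i} (\<lambda>_. G) i) (carrier G)"
    proof (rule inj_onI)
      fix x y assume "single {i} (\<lambda>_. G) i x = single {i} (\<lambda>_. G) i y"
      from fun_cong[OF this, of i] show "x = y" by (simp add: single_def)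
    qed
  qed (rule h.homh)
  then show ?thesis by (rule is_isoI)
qed

text \<open>Each label class is countably infinite on both sides. Bijections \<open>p l\<close>
  between corresponding classes are glued together.\<close>

lemma bij_betw_respecting_labels:
  assumes "countable I" "countable J"
    and I: "\<And>l. infinite {i \<in> I. a i = l}" and J: "\<And>l. infinite {j \<in> J. b j = l}"
  obtains \<pi> where "bij_betw \<pi> I J" "\<And>i. i \<in> I \<Longrightarrow> b (\<pi> i) = a i"
proof -
  have "\<exists>p. bij_betw p {i \<in> I. a i = l} {j \<in> J. b j = l}" for l
  proof -
    have "countable {i \<in> I. a i = l}" "countable {j \<in> J. b j = l}" using assms(1,2) by auto
    with I[of l] J[of l] show ?thesis
      by (meson bij_betw_trans bij_betw_inv_into to_nat_on_infinite)
  qed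
  then obtain p where p: "\<And>l. bij_betw (p l) {i \<in> I. a i = l} {j \<in> J. b j = l}"
    by metis
  define \<pi> where "\<pi> i = p (a i) i" for i
  have mem: "\<pi> i \<in> J" "b (\<pi> i) = a i" if "i \<in> I" for i
    using bij_betwE[OF p[of "a i"]] that unfolding \<pi>_def by blast+
  have "inj_on \<pi> I"
  proof (rule inj_onI)
    fix i i' assume *: "i \<in> I" "i' \<in> I" "\<pi> i = \<pi> i'"
    then have "a i = a i'" using mem by metis
    then have "i \<in> {i' \<in> I. a i' = a i}" "i' \<in> {i' \<in> I. a i' = a i}" "p (a i) i = p (a i) i'"
      using * by (simp_all add: \<pi>_def)
    then show "i = i'" by (intro inj_onD[OF bij_betw_imp_inj_on[OF p[of "a i"]]])
  qed
  moreover have "j \<in> \<pi> ` I" if "j \<in> J" for j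
  proof -
    have "j \<in> p (b j) ` {i \<in> I. a i = b j}"
      using bij_betw_imp_surj_on[OF p[of "b j"]] that by blast
    then obtain i where "i \<in> I" "a i = b j" "j = p (b j) i" by blast
    then have "j = \<pi> i" by (simp add: \<pi>_def)
    with \<open>i \<in> I\<close> show ?thesis by blast
  qed
  ultimately have "bij_betw \<pi> I J" using mem by (auto simp: bij_betw_def)
  then show thesis using mem that by blast
qed

section \<open>Restricted wreath products\<close>

text \<open>The left regular action of \<open>Q\<close> on functions from \<open>Q\<close> to
  \<open>N\<close>; it moves the value at \<open>q\<close> to the point \<open>p q\<close>.\<close>

definition translate :: "('q, 'c) monoid_scheme \<Rightarrow> 'q \<Rightarrow> ('q \<Rightarrow> 'n) \<Rightarrow> 'q \<Rightarrow> 'n" where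
  "translate Q p f = (\<lambda>r\<in>carrier Q. f (inv\<^bsub>Q\<^esub> p \<otimes>\<^bsub>Q\<^esub> r))"

text \<open>The semidirect product of the finitely supported functions with \<open>Q\<close>, base
  component first.\<close>

definition wreath :: "('n, 'a) monoid_scheme \<Rightarrow> ('q, 'c) monoid_scheme \<Rightarrow> (('q \<Rightarrow> 'n) \<times> 'q) monoid" where
  "wreath N Q =
    \<lparr>carrier = carrier (sum_group (carrier Q) (\<lambda>_. N)) \<times> carrier Q,
     monoid.mult = (\<lambda>(f, p) (g, q). (f \<otimes>\<^bsub>sum_group (carrier Q) (\<lambda>_. N)\<^esub> translate Q p g, p \<otimes>\<^bsub>Q\<^esub> q)),
     one = (\<one>\<^bsub>sum_group (carrier Q) (\<lambda>_. N)\<^esub>, \<one>\<^bsub>Q\<^esub>)\<rparr>"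

locale wreath_product = N: group N + Q: group Q
  for N :: "('n, 'a) monoid_scheme" and Q :: "('q, 'c) monoid_scheme"
begin

abbreviation B where "B \<equiv> sum_group (carrier Q) (\<lambda>_. N)"
abbreviation W where "W \<equiv> wreath N Q"
abbreviation \<delta> where "\<delta> p n \<equiv> single (carrier Q) (\<lambda>_. N) p n"

sublocale B: group_family "carrier Q" "\<lambda>_. N"
  by (rule group_family.intro) (rule N.is_group)

lemma carrier_W: "carrier W = carrier B \<times> carrier Q"
  and one_W: "\<one>\<^bsub>W\<^esub> = (\<one>\<^bsub>B\<^esub>, \<one>\<^bsub>Q\<^esub>)"
  and mult_W: "(f, p) \<otimes>\<^bsub>W\<^esub> (g, q) = (f \<otimes>\<^bsub>B\<^esub> translate Q p g, p \<otimes>\<^bsub>Q\<^esub> q)"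
  by (simp_all add: wreath_def del: one_sum_group mult_sum_group)

lemma translate_closed:
  assumes p: "p \<in> carrier Q" and f: "f \<in> carrier B"
  shows "translate Q p f \<in> carrier B"
proof -
  have "{r \<in> carrier Q. translate Q p f r \<noteq> \<one>\<^bsub>N\<^esub>} \<subseteq> (\<lambda>r. p \<otimes>\<^bsub>Q\<^esub> r) ` {r \<in> carrier Q. f r \<noteq> \<one>\<^bsub>N\<^esub>}"
  proof
    fix r assume "r \<in> {r \<in> carrier Q. translate Q p f r \<noteq> \<one>\<^bsub>N\<^esub>}"
    then have "r = p \<otimes>\<^bsub>Q\<^esub> (inv\<^bsub>Q\<^esub> p \<otimes>\<^bsub>Q\<^esub> r)" "inv\<^bsub>Q\<^esub> p \<otimes>\<^bsub>Q\<^esub> r \<in> {r \<in> carrier Q. f r \<noteq> \<one>\<^bsub>N\<^esub>}"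
      using p by (auto simp: translate_def Q.inv_mult_cancel)
    then show "r \<in> (\<lambda>r. p \<otimes>\<^bsub>Q\<^esub> r) ` {r \<in> carrier Q. f r \<noteq> \<one>\<^bsub>N\<^esub>}" by blast
  qed
  then have "finite {r \<in> carrier Q. translate Q p f r \<noteq> \<one>\<^bsub>N\<^esub>}"
    by (rule finite_subset) (use f in \<open>auto simp: B.mem_carrier\<close>)
  then show ?thesis
    using f p by (auto simp: B.mem_carrier) (auto simp: translate_def)
qed

lemma translate_mult:
  assumes "p \<in> carrier Q"
  shows "translate Q p (f \<otimes>\<^bsub>B\<^esub> g) = translate Q p f \<otimes>\<^bsub>B\<^esub> translate Q p g"
  using assms by (auto simp: translate_def fun_eq_iff)

lemma translate_one: "p \<in> carrier Q \<Longrightarrow> translate Q p \<one>\<^bsub>B\<^esub> = \<one>\<^bsub>B\<^esub>"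
  by (auto simp: translate_def fun_eq_iff)

lemma translate_translate:
  "p \<in> carrier Q \<Longrightarrow> q \<in> carrier Q \<Longrightarrow> translate Q p (translate Q q f) = translate Q (p \<otimes>\<^bsub>Q\<^esub> q) f"
  by (auto simp: translate_def fun_eq_iff Q.inv_mult_group Q.m_assoc)

lemma translate_id: "f \<in> carrier B \<Longrightarrow> translate Q \<one>\<^bsub>Q\<^esub> f = f"
  by (auto simp: translate_def fun_eq_iff B.mem_carrier extensional_def)

lemma translate_\<delta>:
  assumes "p \<in> carrier Q" "q \<in> carrier Q"
  shows "translate Q p (\<delta> q n) = \<delta> (p \<otimes>\<^bsub>Q\<^esub> q) n"
proof -
  have "inv\<^bsub>Q\<^esub> p \<otimes>\<^bsub>Q\<^esub> r = q \<longleftrightarrow> r = p \<otimes>\<^bsub>Q\<^esub> q" if "r \<in> carrier Q" for r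
    using assms that by (metis Q.inv_closed Q.inv_mult_cancel)
  then show ?thesis using assms by (auto simp: translate_def single_def fun_eq_iff)
qed

lemmas translate_simps = translate_closed translate_mult translate_one translate_translate
  translate_id translate_\<delta>

sublocale W: group W
proof (rule groupI)
  fix x y assume "x \<in> carrier W" "y \<in> carrier W"
  then show "x \<otimes>\<^bsub>W\<^esub> y \<in> carrier W"
    by (auto simp: carrier_W mult_W translate_simps simp del: mult_sum_group)
next
  show "\<one>\<^bsub>W\<^esub> \<in> carrier W"
    by (simp add: carrier_W one_W del: one_sum_group)
next
  fix x y z assume "x \<in> carrier W" "y \<in> carrier W" "z \<in> carrier W"
  then show "x \<otimes>\<^bsub>W\<^esub> y \<otimes>\<^bsub>W\<^esub> z = x \<otimes>\<^bsub>W\<^esub> (y \<otimes>\<^bsub>W\<^esub> z)"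
    by (auto simp: carrier_W mult_W translate_simps B.S.m_assoc Q.m_assoc simp del: mult_sum_group)
next
  fix x assume "x \<in> carrier W"
  then show "\<one>\<^bsub>W\<^esub> \<otimes>\<^bsub>W\<^esub> x = x"
    by (auto simp: carrier_W mult_W one_W translate_simps simp del: mult_sum_group one_sum_group)
next
  fix x assume "x \<in> carrier W"
  then obtain f p where x: "x = (f, p)" "f \<in> carrier B" "p \<in> carrier Q" by (auto simp: carrier_W)
  let ?y = "(translate Q (inv\<^bsub>Q\<^esub> p) (inv\<^bsub>B\<^esub> f), inv\<^bsub>Q\<^esub> p)"
  have "?y \<in> carrier W" using x by (simp add: carrier_W translate_simps del: inv_sum_group)
  moreover have "?y \<otimes>\<^bsub>W\<^esub> x = \<one>\<^bsub>W\<^esub>"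
    using x translate_mult[of "inv\<^bsub>Q\<^esub> p" "inv\<^bsub>B\<^esub> f" f] translate_one[of "inv\<^bsub>Q\<^esub> p"]
    by (simp add: mult_W one_W del: mult_sum_group one_sum_group inv_sum_group)
  ultimately show "\<exists>y\<in>carrier W. y \<otimes>\<^bsub>W\<^esub> x = \<one>\<^bsub>W\<^esub>" by blast
qed

declare one_sum_group [simp del] mult_sum_group [simp del] inv_sum_group [simp del]

lemma inv_W:
  assumes "f \<in> carrier B" "p \<in> carrier Q"
  shows "inv\<^bsub>W\<^esub> (f, p) = (translate Q (inv\<^bsub>Q\<^esub> p) (inv\<^bsub>B\<^esub> f), inv\<^bsub>Q\<^esub> p)"
proof (rule W.inv_equality)
  show "(translate Q (inv\<^bsub>Q\<^esub> p) (inv\<^bsub>B\<^esub> f), inv\<^bsub>Q\<^esub> p) \<otimes>\<^bsub>W\<^esub> (f, p) = \<one>\<^bsub>W\<^esub>"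
    using assms by (simp add: mult_W one_W translate_simps flip: translate_mult)
qed (use assms in \<open>simp_all add: carrier_W translate_simps\<close>)

lemma conj_base:
  assumes "f \<in> carrier B" "p \<in> carrier Q" "g \<in> carrier B"
  shows "(f, p) \<otimes>\<^bsub>W\<^esub> (g, \<one>\<^bsub>Q\<^esub>) \<otimes>\<^bsub>W\<^esub> inv\<^bsub>W\<^esub> (f, p) = (f \<otimes>\<^bsub>B\<^esub> translate Q p g \<otimes>\<^bsub>B\<^esub> inv\<^bsub>B\<^esub> f, \<one>\<^bsub>Q\<^esub>)"
  using assms by (simp add: mult_W inv_W translate_simps B.S.m_assoc)

lemma top_hom: "group_hom W Q snd"
  by unfold_locales (auto simp: hom_def carrier_W mult_W)

lemma base_hom: "group_hom B W (\<lambda>f. (f, \<one>\<^bsub>Q\<^esub>))"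
  by unfold_locales (auto simp: hom_def carrier_W mult_W translate_simps)

lemma complement_hom: "group_hom Q W (\<lambda>q. (\<one>\<^bsub>B\<^esub>, q))"
  by unfold_locales (auto simp: hom_def carrier_W mult_W translate_simps)

lemma \<delta>_hom:
  assumes "p \<in> carrier Q" shows "group_hom N W (\<lambda>n. (\<delta> p n, \<one>\<^bsub>Q\<^esub>))"
proof -
  interpret d: group_hom N B "\<delta> p" by (rule B.single_hom[OF assms])
  show ?thesis
    using group_hom.hom_mult[OF base_hom] by unfold_locales (auto simp: hom_def carrier_W)
qed

lemma kernel_top: "kernel W Q snd = carrier B \<times> {\<one>\<^bsub>Q\<^esub>}"
  by (auto simp: kernel_def carrier_W)

section \<open>Normal subgroups and the pseudocentre of a wreath product\<close>

text \<open>Conjugation by elements of the complement \<open>Q\<close> carries the copy of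
  \<open>N\<close> at \<open>p\<close> to the copy at any other point, and these copies generate the
  base.\<close>

lemma base_subset_normal:
  assumes M: "M \<lhd> W" and p: "p \<in> carrier Q" and \<delta>: "\<And>n. n \<in> carrier N \<Longrightarrow> (\<delta> p n, \<one>\<^bsub>Q\<^esub>) \<in> M"
  shows "carrier B \<times> {\<one>\<^bsub>Q\<^esub>} \<subseteq> M"
proof -
  let ?M = "{f \<in> carrier B. (f, \<one>\<^bsub>Q\<^esub>) \<in> M}"
  have sub: "subgroup ?M B"
    using group_hom.normal_vimage[OF base_hom M] by (rule normal_imp_subgroup)
  have single: "\<delta> q n \<in> ?M" if q: "q \<in> carrier Q" and n: "n \<in> carrier N" for q n
  proof -
    define t where "t = q \<otimes>\<^bsub>Q\<^esub> inv\<^bsub>Q\<^esub> p"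
    have t: "t \<in> carrier Q" "t \<otimes>\<^bsub>Q\<^esub> p = q" using p q by (simp_all add: t_def Q.m_assoc)
    have "(\<one>\<^bsub>B\<^esub>, t) \<otimes>\<^bsub>W\<^esub> (\<delta> p n, \<one>\<^bsub>Q\<^esub>) \<otimes>\<^bsub>W\<^esub> inv\<^bsub>W\<^esub> (\<one>\<^bsub>B\<^esub>, t) \<in> M"
      using W.normal_invE(2)[OF M _ \<delta>[OF n], of "(\<one>\<^bsub>B\<^esub>, t)"] t(1) by (simp add: carrier_W)
    moreover have "(\<one>\<^bsub>B\<^esub>, t) \<otimes>\<^bsub>W\<^esub> (\<delta> p n, \<one>\<^bsub>Q\<^esub>) \<otimes>\<^bsub>W\<^esub> inv\<^bsub>W\<^esub> (\<one>\<^bsub>B\<^esub>, t) = (\<delta> q n, \<one>\<^bsub>Q\<^esub>)"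
      using conj_base[of "\<one>\<^bsub>B\<^esub>" t "\<delta> p n"] t p n q B.single_closed by (simp add: translate_simps)
    ultimately show ?thesis using B.single_closed[OF q n] by simp
  qed
  have "f \<in> ?M" if f: "f \<in> carrier B" for f
    using sub f by (rule B.mem_subgroup_if_singles) (use single B.coord_closed[OF f] in blast)
  then show ?thesis by blast
qed

lemma base_subset_if_commutators:
  assumes M: "M \<lhd> W" and N: "perfect N"
    and c: "\<And>m n. m \<in> carrier N \<Longrightarrow> n \<in> carrier N \<Longrightarrow>
      (\<delta> \<one>\<^bsub>Q\<^esub> (n \<otimes>\<^bsub>N\<^esub> m \<otimes>\<^bsub>N\<^esub> inv\<^bsub>N\<^esub> n \<otimes>\<^bsub>N\<^esub> inv\<^bsub>N\<^esub> m), \<one>\<^bsub>Q\<^esub>) \<in> M"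
  shows "carrier B \<times> {\<one>\<^bsub>Q\<^esub>} \<subseteq> M"
proof -
  interpret d: group_hom N W "\<lambda>n. (\<delta> \<one>\<^bsub>Q\<^esub> n, \<one>\<^bsub>Q\<^esub>)" by (rule \<delta>_hom) simp
  have "{n \<in> carrier N. (\<delta> \<one>\<^bsub>Q\<^esub> n, \<one>\<^bsub>Q\<^esub>) \<in> M} = carrier N"
    using normal_imp_subgroup[OF d.normal_vimage[OF M]] c
    by (intro N.subgroup_perfect_eq N) auto
  then show ?thesis by (intro base_subset_normal[OF M, of "\<one>\<^bsub>Q\<^esub>"]) auto
qed

text \<open>Two commutators produce what \<open>base_subset_if_commutators\<close> asks for. The
  first, of \<open>\<delta> 1 n\<close> with \<open>(f, q)\<close>, is a base element
  \<open>k\<close> of \<open>M\<close> with value \<open>n\<close> at the unit of \<open>Q\<close>.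
  The second, of \<open>k\<close> with \<open>\<delta> 1 m\<close>, is concentrated at the unit and
  equals the commutator of \<open>n\<close> and \<open>m\<close> there.\<close>

lemma base_subset_normal_if_not_in_base:
  assumes M: "M \<lhd> W" and N: "perfect N" and x: "(f, q) \<in> M" "q \<noteq> \<one>\<^bsub>Q\<^esub>"
  shows "carrier B \<times> {\<one>\<^bsub>Q\<^esub>} \<subseteq> M"
proof (rule base_subset_if_commutators[OF M N])
  fix m n assume m: "m \<in> carrier N" and n: "n \<in> carrier N"
  have sub: "subgroup M W" using M by (rule normal_imp_subgroup)
  have fq: "f \<in> carrier B" "q \<in> carrier Q"
    using subgroup.mem_carrier[OF sub x(1)] by (auto simp: carrier_W)
  have B: "\<delta> \<one>\<^bsub>Q\<^esub> n \<in> carrier B" "\<delta> \<one>\<^bsub>Q\<^esub> m \<in> carrier B" using m n by (auto intro: B.single_closed)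
  define u where "u = (\<delta> \<one>\<^bsub>Q\<^esub> n, \<one>\<^bsub>Q\<^esub>)"
  have u: "u \<in> carrier W" using B by (simp add: u_def carrier_W)
  have xW: "(f, q) \<in> carrier W" using fq by (simp add: carrier_W)
  have "u \<otimes>\<^bsub>W\<^esub> (f, q) \<otimes>\<^bsub>W\<^esub> inv\<^bsub>W\<^esub> u \<otimes>\<^bsub>W\<^esub> inv\<^bsub>W\<^esub> (f, q) \<in> M"
    by (intro subgroup.m_closed[OF sub] subgroup.m_inv_closed[OF sub] W.normal_invE(2)[OF M] x u)
  also have "u \<otimes>\<^bsub>W\<^esub> (f, q) \<otimes>\<^bsub>W\<^esub> inv\<^bsub>W\<^esub> u \<otimes>\<^bsub>W\<^esub> inv\<^bsub>W\<^esub> (f, q) =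
      u \<otimes>\<^bsub>W\<^esub> ((f, q) \<otimes>\<^bsub>W\<^esub> inv\<^bsub>W\<^esub> u \<otimes>\<^bsub>W\<^esub> inv\<^bsub>W\<^esub> (f, q))"
    using u xW by (simp add: W.m_assoc)
  also have "inv\<^bsub>W\<^esub> u = (inv\<^bsub>B\<^esub> (\<delta> \<one>\<^bsub>Q\<^esub> n), \<one>\<^bsub>Q\<^esub>)"
    using B by (simp add: u_def inv_W translate_simps)
  also have "(f, q) \<otimes>\<^bsub>W\<^esub> (inv\<^bsub>B\<^esub> (\<delta> \<one>\<^bsub>Q\<^esub> n), \<one>\<^bsub>Q\<^esub>) \<otimes>\<^bsub>W\<^esub> inv\<^bsub>W\<^esub> (f, q) =
      (f \<otimes>\<^bsub>B\<^esub> translate Q q (inv\<^bsub>B\<^esub> (\<delta> \<one>\<^bsub>Q\<^esub> n)) \<otimes>\<^bsub>B\<^esub> inv\<^bsub>B\<^esub> f, \<one>\<^bsub>Q\<^esub>)" (is "_ = (?g, _)")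
    using B fq by (intro conj_base) auto
  finally have "(\<delta> \<one>\<^bsub>Q\<^esub> n \<otimes>\<^bsub>B\<^esub> ?g, \<one>\<^bsub>Q\<^esub>) \<in> M"
    using B fq by (simp add: u_def mult_W translate_simps)
  moreover define k where "k = \<delta> \<one>\<^bsub>Q\<^esub> n \<otimes>\<^bsub>B\<^esub> ?g"
  ultimately have kM: "(k, \<one>\<^bsub>Q\<^esub>) \<in> M" by simp
  have k: "k \<in> carrier B" using B fq by (simp add: k_def translate_closed)
  \<comment> \<open>The conjugate \<open>?g\<close> is supported at the point \<open>q\<close>,
    which differs from the unit of \<open>Q\<close>.\<close>
  have "?g \<one>\<^bsub>Q\<^esub> = \<one>\<^bsub>N\<^esub>"
    using B fq x(2) B.coord_closed[OF fq(1)]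
    by (simp add: mult_sum_group inv_sum_group translate_def single_def)
  then have k1: "k \<one>\<^bsub>Q\<^esub> = n"
    using n by (simp add: k_def mult_sum_group single_def)
  define v where "v = (\<delta> \<one>\<^bsub>Q\<^esub> m, \<one>\<^bsub>Q\<^esub>)"
  have v: "v \<in> carrier W" using B by (simp add: v_def carrier_W)
  have "(k, \<one>\<^bsub>Q\<^esub>) \<otimes>\<^bsub>W\<^esub> (v \<otimes>\<^bsub>W\<^esub> inv\<^bsub>W\<^esub> (k, \<one>\<^bsub>Q\<^esub>) \<otimes>\<^bsub>W\<^esub> inv\<^bsub>W\<^esub> v) \<in> M"
    by (intro subgroup.m_closed[OF sub] subgroup.m_inv_closed[OF sub] W.normal_invE(2)[OF M] kM v)
  also have "(k, \<one>\<^bsub>Q\<^esub>) \<otimes>\<^bsub>W\<^esub> (v \<otimes>\<^bsub>W\<^esub> inv\<^bsub>W\<^esub> (k, \<one>\<^bsub>Q\<^esub>) \<otimes>\<^bsub>W\<^esub> inv\<^bsub>W\<^esub> v) =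
      (k \<otimes>\<^bsub>B\<^esub> \<delta> \<one>\<^bsub>Q\<^esub> m \<otimes>\<^bsub>B\<^esub> inv\<^bsub>B\<^esub> k \<otimes>\<^bsub>B\<^esub> inv\<^bsub>B\<^esub> (\<delta> \<one>\<^bsub>Q\<^esub> m), \<one>\<^bsub>Q\<^esub>)"
    using k B by (simp add: v_def mult_W inv_W translate_simps B.S.m_assoc)
  \<comment> \<open>Away from the unit of \<open>Q\<close> the factors from \<open>\<delta>\<close>
    are trivial and \<open>k\<close> cancels against its inverse.\<close>
  also have "k \<otimes>\<^bsub>B\<^esub> \<delta> \<one>\<^bsub>Q\<^esub> m \<otimes>\<^bsub>B\<^esub> inv\<^bsub>B\<^esub> k \<otimes>\<^bsub>B\<^esub> inv\<^bsub>B\<^esub> (\<delta> \<one>\<^bsub>Q\<^esub> m) =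
      \<delta> \<one>\<^bsub>Q\<^esub> (n \<otimes>\<^bsub>N\<^esub> m \<otimes>\<^bsub>N\<^esub> inv\<^bsub>N\<^esub> n \<otimes>\<^bsub>N\<^esub> inv\<^bsub>N\<^esub> m)"
    using k B k1 m n B.coord_closed[OF k]
    by (auto simp: mult_sum_group inv_sum_group single_def fun_eq_iff)
  finally show "(\<delta> \<one>\<^bsub>Q\<^esub> (n \<otimes>\<^bsub>N\<^esub> m \<otimes>\<^bsub>N\<^esub> inv\<^bsub>N\<^esub> n \<otimes>\<^bsub>N\<^esub> inv\<^bsub>N\<^esub> m), \<one>\<^bsub>Q\<^esub>) \<in> M" .
qed

text \<open>The element \<open>n\<close> supplies a base element whose centralizer stays in the
  base, which bounds the pseudocentre from above. For the lower bound, every \<open>M\<close>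
  containing some centralizer must contain the base.\<close>

lemma pseudocentre_wreath:
  assumes N: "perfect N" and n: "n \<in> carrier N" "n \<noteq> \<one>\<^bsub>N\<^esub>" and Q: "infinite (carrier Q)"
  shows "pseudocentre W = carrier B \<times> {\<one>\<^bsub>Q\<^esub>}"
proof
  have B: "\<delta> \<one>\<^bsub>Q\<^esub> n \<in> carrier B" using n by (simp add: B.single_closed)
  have "centralizer W (\<delta> \<one>\<^bsub>Q\<^esub> n, \<one>\<^bsub>Q\<^esub>) \<subseteq> kernel W Q snd"
  proof
    fix y assume y: "y \<in> centralizer W (\<delta> \<one>\<^bsub>Q\<^esub> n, \<one>\<^bsub>Q\<^esub>)"
    obtain g q where gq: "y = (g, q)" by fastforce
    with y have g: "g \<in> carrier B" and q: "q \<in> carrier Q"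
      and eq: "g \<otimes>\<^bsub>B\<^esub> \<delta> q n = \<delta> \<one>\<^bsub>Q\<^esub> n \<otimes>\<^bsub>B\<^esub> g"
      by (auto simp: centralizer_def carrier_W mult_W translate_simps)
    have "q = \<one>\<^bsub>Q\<^esub>"
    proof (rule ccontr)
      assume "q \<noteq> \<one>\<^bsub>Q\<^esub>"
      \<comment> \<open>At the unit of \<open>Q\<close> the function \<open>\<delta> q n\<close> is
        trivial while \<open>\<delta> 1 n\<close> has value \<open>n\<close>.\<close>
      then have "g \<one>\<^bsub>Q\<^esub> = n \<otimes>\<^bsub>N\<^esub> g \<one>\<^bsub>Q\<^esub>"
        using fun_cong[OF eq, of "\<one>\<^bsub>Q\<^esub>"] B.coord_closed[OF g] by (simp add: mult_sum_group single_def split: if_splits)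
      then show False using n B.coord_closed[OF g, of "\<one>\<^bsub>Q\<^esub>"] by simp
    qed
    then show "y \<in> kernel W Q snd" using gq g by (simp add: kernel_top)
  qed
  then show "pseudocentre W \<subseteq> carrier B \<times> {\<one>\<^bsub>Q\<^esub>}"
    using group_hom.normal_kernel[OF top_hom] group_hom.hom_closed[OF base_hom B] unfolding kernel_top W.mem_pseudocentre subset_iff
    by blast
  show "carrier B \<times> {\<one>\<^bsub>Q\<^esub>} \<subseteq> pseudocentre W"
  proof
    fix y assume y: "y \<in> carrier B \<times> {\<one>\<^bsub>Q\<^esub>}"
    show "y \<in> pseudocentre W"
      unfolding W.mem_pseudocentre
    proof (intro ballI allI impI)
      fix x M assume x: "x \<in> carrier W" and M: "M \<lhd> W" "centralizer W x \<subseteq> M"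
      obtain f q where fq: "x = (f, q)" "f \<in> carrier B" "q \<in> carrier Q" using x by (auto simp: carrier_W)
      have "carrier B \<times> {\<one>\<^bsub>Q\<^esub>} \<subseteq> M"
      proof (cases "q = \<one>\<^bsub>Q\<^esub>")
        case False
        \<comment> \<open>Outside the base, \<open>x\<close> itself is an element of
          \<open>M\<close>, since it commutes with itself.\<close>
        have "x \<in> centralizer W x" using x by (simp add: centralizer_def)
        then show ?thesis using M fq False by (intro base_subset_normal_if_not_in_base[OF M(1) N, of f q]) auto
      next
        case True
        \<comment> \<open>For \<open>x\<close> in the base, the infinite group \<open>Q\<close> has
          a point \<open>p\<close> outside the finite support of \<open>f\<close>, and the whole
          copy of \<open>N\<close> at \<open>p\<close> centralizes \<open>x\<close>.\<close>
        have "finite {p \<in> carrier Q. f p \<noteq> \<one>\<^bsub>N\<^esub>}" using fq by (simp add: B.mem_carrier)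
        then obtain p where p: "p \<in> carrier Q" "f p = \<one>\<^bsub>N\<^esub>"
          using Q by (metis (mono_tags, lifting) mem_Collect_eq rev_finite_subset subsetI)
        have "(\<delta> p m, \<one>\<^bsub>Q\<^esub>) \<in> centralizer W x" if m: "m \<in> carrier N" for m
        proof -
          have "\<delta> p m \<otimes>\<^bsub>B\<^esub> f = f \<otimes>\<^bsub>B\<^esub> \<delta> p m"
            using p m B.coord_closed[OF fq(2)] by (auto simp: mult_sum_group single_def fun_eq_iff)
          then show ?thesis
            using fq True B.single_closed[OF p(1) m]
            by (simp add: centralizer_def carrier_W mult_W translate_id)
        qed
        then show ?thesis using M p by (intro base_subset_normal[OF M(1), of p]) auto
      qed
      then show "y \<in> M" using y by blast
    qed
  qed
qed

section \<open>Properties inherited by wreath products\<close>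

text \<open>A normal subgroup with all commutators contains the base because \<open>N\<close> is
  perfect and the complement because \<open>Q\<close> is perfect; together these generate
  \<open>W\<close>.\<close>

lemma perfect_wreath:
  assumes N: "perfect N" and Q: "perfect Q"
  shows "perfect W"
proof (rule W.perfectI)
  fix M assume M: "M \<lhd> W"
    and c: "\<And>x y. x \<in> carrier W \<Longrightarrow> y \<in> carrier W \<Longrightarrow> x \<otimes>\<^bsub>W\<^esub> y \<otimes>\<^bsub>W\<^esub> inv\<^bsub>W\<^esub> x \<otimes>\<^bsub>W\<^esub> inv\<^bsub>W\<^esub> y \<in> M"
  have sub: "subgroup M W" using M by (rule normal_imp_subgroup)
  interpret d: group_hom N W "\<lambda>n. (\<delta> \<one>\<^bsub>Q\<^esub> n, \<one>\<^bsub>Q\<^esub>)" by (rule \<delta>_hom) simp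
  interpret t: group_hom Q W "\<lambda>q. (\<one>\<^bsub>B\<^esub>, q)" by (rule complement_hom)
  have base: "carrier B \<times> {\<one>\<^bsub>Q\<^esub>} \<subseteq> M"
  proof (rule base_subset_if_commutators[OF M N])
    fix m n assume mn: "m \<in> carrier N" "n \<in> carrier N"
    have "(\<delta> \<one>\<^bsub>Q\<^esub> (n \<otimes>\<^bsub>N\<^esub> m \<otimes>\<^bsub>N\<^esub> inv\<^bsub>N\<^esub> n \<otimes>\<^bsub>N\<^esub> inv\<^bsub>N\<^esub> m), \<one>\<^bsub>Q\<^esub>) =
      (\<delta> \<one>\<^bsub>Q\<^esub> n, \<one>\<^bsub>Q\<^esub>) \<otimes>\<^bsub>W\<^esub> (\<delta> \<one>\<^bsub>Q\<^esub> m, \<one>\<^bsub>Q\<^esub>) \<otimes>\<^bsub>W\<^esub> inv\<^bsub>W\<^esub> (\<delta> \<one>\<^bsub>Q\<^esub> n, \<one>\<^bsub>Q\<^esub>) \<otimes>\<^bsub>W\<^esub> inv\<^bsub>W\<^esub> (\<delta> \<one>\<^bsub>Q\<^esub> m, \<one>\<^bsub>Q\<^esub>)"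
      using mn by (simp only: d.hom_mult d.hom_inv N.m_closed N.inv_closed)
    then show "(\<delta> \<one>\<^bsub>Q\<^esub> (n \<otimes>\<^bsub>N\<^esub> m \<otimes>\<^bsub>N\<^esub> inv\<^bsub>N\<^esub> n \<otimes>\<^bsub>N\<^esub> inv\<^bsub>N\<^esub> m), \<one>\<^bsub>Q\<^esub>) \<in> M"
      using c[OF d.hom_closed d.hom_closed] mn by simp
  qed
  have "(\<one>\<^bsub>B\<^esub>, p \<otimes>\<^bsub>Q\<^esub> q \<otimes>\<^bsub>Q\<^esub> inv\<^bsub>Q\<^esub> p \<otimes>\<^bsub>Q\<^esub> inv\<^bsub>Q\<^esub> q) \<in> M" if "p \<in> carrier Q" "q \<in> carrier Q" for p q
  proof -
    have "(\<one>\<^bsub>B\<^esub>, p \<otimes>\<^bsub>Q\<^esub> q \<otimes>\<^bsub>Q\<^esub> inv\<^bsub>Q\<^esub> p \<otimes>\<^bsub>Q\<^esub> inv\<^bsub>Q\<^esub> q) =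
      (\<one>\<^bsub>B\<^esub>, p) \<otimes>\<^bsub>W\<^esub> (\<one>\<^bsub>B\<^esub>, q) \<otimes>\<^bsub>W\<^esub> inv\<^bsub>W\<^esub> (\<one>\<^bsub>B\<^esub>, p) \<otimes>\<^bsub>W\<^esub> inv\<^bsub>W\<^esub> (\<one>\<^bsub>B\<^esub>, q)"
      using that by (simp only: t.hom_mult t.hom_inv Q.m_closed Q.inv_closed)
    then show ?thesis using c[OF t.hom_closed t.hom_closed] that by simp
  qed
  then have "{q \<in> carrier Q. (\<one>\<^bsub>B\<^esub>, q) \<in> M} = carrier Q"
    using normal_imp_subgroup[OF t.normal_vimage[OF M]]
    by (intro Q.subgroup_perfect_eq Q) auto
  then have top: "(\<one>\<^bsub>B\<^esub>, q) \<in> M" if "q \<in> carrier Q" for q using that by blast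
  show "carrier W \<subseteq> M"
  proof
    fix x assume "x \<in> carrier W"
    then obtain f q where fq: "x = (f, q)" "f \<in> carrier B" "q \<in> carrier Q" by (auto simp: carrier_W)
    then have "x = (f, \<one>\<^bsub>Q\<^esub>) \<otimes>\<^bsub>W\<^esub> (\<one>\<^bsub>B\<^esub>, q)" by (simp add: mult_W translate_simps)
    then show "x \<in> M" using subgroup.m_closed[OF sub] base top fq by auto
  qed
qed

text \<open>Projection to \<open>Q\<close> forces a torsion element into the base, which is a direct
  sum of torsion-free groups.\<close>

lemma torsion_free_wreath:
  assumes N: "torsion_free N" and Q: "torsion_free Q"
  shows "torsion_free W"
  unfolding torsion_free_def
proof (intro ballI allI impI)
  fix x and n :: nat assume x: "x \<in> carrier W" and n: "n > 0" "x [^]\<^bsub>W\<^esub> n = \<one>\<^bsub>W\<^esub>"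
  have "snd x [^]\<^bsub>Q\<^esub> n = \<one>\<^bsub>Q\<^esub>" using group_hom.hom_nat_pow[OF top_hom x, of n] n(2) by (simp add: one_W)
  then have "snd x = \<one>\<^bsub>Q\<^esub>" using Q n(1) group_hom.hom_closed[OF top_hom x] unfolding torsion_free_def by blast
  then obtain f where f: "x = (f, \<one>\<^bsub>Q\<^esub>)" "f \<in> carrier B" using x by (auto simp: carrier_W)
  have "f [^]\<^bsub>B\<^esub> n = \<one>\<^bsub>B\<^esub>"
    using group_hom.hom_nat_pow[OF base_hom f(2), of n] n(2) f(1) by (simp add: one_W)
  then have "f = \<one>\<^bsub>B\<^esub>"
    using B.torsion_free_sum_group N n(1) f(2) unfolding torsion_free_def by blast
  then show "x = \<one>\<^bsub>W\<^esub>" using f(1) by (simp add: one_W)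
qed

text \<open>The generators are enclosed in a finite subgroup \<open>F \<times> Q0\<close>:
  \<open>Q0\<close> is generated by their top components, and \<open>F\<close> consists of the
  functions supported in a finite \<open>Q0\<close>-invariant set \<open>A\<close> with values in
  the finite group \<open>N0\<close> generated by all their base values.\<close>

lemma locally_finite_wreath:
  assumes N: "locally_finite N" and Q: "locally_finite Q"
  shows "locally_finite W"
  unfolding locally_finite_def
proof (intro allI impI)
  fix S assume S: "finite S \<and> S \<subseteq> carrier W"
  define Q0 where "Q0 = generate Q (snd ` S)"
  define A0 where "A0 = (\<Union>s\<in>S. {p \<in> carrier Q. fst s p \<noteq> \<one>\<^bsub>N\<^esub>})"
  \<comment> \<open>Closing the supports \<open>A0\<close> under left multiplication by
    \<open>Q0\<close> is what makes \<open>F\<close> invariant under translation by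
    \<open>Q0\<close>.\<close>
  define A where "A = (\<lambda>(q, a). q \<otimes>\<^bsub>Q\<^esub> a) ` (Q0 \<times> A0)"
  define N0 where "N0 = generate N ((\<lambda>(s, p). fst s p) ` (S \<times> A0))"
  have S_cl: "fst s \<in> carrier B" "snd s \<in> carrier Q" if "s \<in> S" for s
    using S that by (auto simp: carrier_W)
  have A0: "A0 \<subseteq> carrier Q" "finite A0"
    using S S_cl(1) by (auto simp: A0_def B.mem_carrier)
  have "finite (snd ` S)" "snd ` S \<subseteq> carrier Q" using S S_cl(2) by auto
  then have Q0: "subgroup Q0 Q" "finite Q0"
    using Q unfolding Q0_def locally_finite_def by (blast intro: Q.generate_is_subgroup)+
  note Q0_cl = subgroup.mem_carrier[OF Q0(1)] subgroup.m_closed[OF Q0(1)] subgroup.m_inv_closed[OF Q0(1)]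
  have "(\<lambda>(s, p). fst s p) ` (S \<times> A0) \<subseteq> carrier N"
    using A0(1) S_cl(1) by (auto intro: B.coord_closed)
  moreover have "finite ((\<lambda>(s, p). fst s p) ` (S \<times> A0))" using S A0(2) by blast
  ultimately have N0: "subgroup N0 N" "finite N0"
    using N unfolding N0_def locally_finite_def by (blast intro: N.generate_is_subgroup)+
  note N0_cl = subgroup.m_closed[OF N0(1)] subgroup.m_inv_closed[OF N0(1)] subgroup.one_closed[OF N0(1)]
  have A: "finite A" "A \<subseteq> carrier Q" using A0 Q0 Q0_cl(1) by (auto simp: A_def)
  have A_cl: "q \<otimes>\<^bsub>Q\<^esub> r \<in> A \<longleftrightarrow> r \<in> A" if "q \<in> Q0" "r \<in> carrier Q" for q r
  proof -
    have *: "q \<otimes>\<^bsub>Q\<^esub> r \<in> A" if "q \<in> Q0" "r \<in> A" for q r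
    proof -
      obtain p a where "p \<in> Q0" "a \<in> A0" "r = p \<otimes>\<^bsub>Q\<^esub> a" using \<open>r \<in> A\<close> by (auto simp: A_def)
      then have "q \<otimes>\<^bsub>Q\<^esub> r = (q \<otimes>\<^bsub>Q\<^esub> p) \<otimes>\<^bsub>Q\<^esub> a" "q \<otimes>\<^bsub>Q\<^esub> p \<in> Q0"
        using \<open>q \<in> Q0\<close> A0(1) Q0_cl by (auto simp: Q.m_assoc subset_iff)
      with \<open>a \<in> A0\<close> show ?thesis by (auto simp: A_def)
    qed
    have "inv\<^bsub>Q\<^esub> q \<otimes>\<^bsub>Q\<^esub> (q \<otimes>\<^bsub>Q\<^esub> r) = r" using that Q0_cl(1) by (simp add: Q.inv_mult_cancel)
    then show ?thesis using *[of q r] *[of "inv\<^bsub>Q\<^esub> q" "q \<otimes>\<^bsub>Q\<^esub> r"] that Q0_cl(3) by metis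
  qed
  define F where "F = {f \<in> extensional (carrier Q). \<forall>p\<in>carrier Q. (p \<in> A \<longrightarrow> f p \<in> N0) \<and> (p \<notin> A \<longrightarrow> f p = \<one>\<^bsub>N\<^esub>)}"
  have finF: "finite F" unfolding F_def by (rule B.finite_box[OF A(1)]) (rule N0)
  have FB: "F \<subseteq> carrier B"
  proof
    fix f assume f: "f \<in> F"
    have "{p \<in> carrier Q. f p \<noteq> \<one>\<^bsub>N\<^esub>} \<subseteq> A" using f by (auto simp: F_def)
    then have "finite {p \<in> carrier Q. f p \<noteq> \<one>\<^bsub>N\<^esub>}" using A(1) by (rule finite_subset)
    moreover have "f p \<in> carrier N" if "p \<in> carrier Q" for p
      using f that subgroup.mem_carrier[OF N0(1)] by (cases "p \<in> A") (auto simp: F_def)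
    ultimately show "f \<in> carrier B" using f by (auto simp: B.mem_carrier) (auto simp: F_def)
  qed
  have tr: "translate Q q f \<in> F" if "q \<in> Q0" "f \<in> F" for q f
  proof -
    have "inv\<^bsub>Q\<^esub> q \<otimes>\<^bsub>Q\<^esub> p \<in> A \<longleftrightarrow> p \<in> A" if "p \<in> carrier Q" for p
      using A_cl[OF Q0_cl(3)[OF \<open>q \<in> Q0\<close>] that] .
    then show ?thesis using that Q0_cl(1)[OF that(1)] by (auto simp: F_def translate_def)
  qed
  have mult: "f \<otimes>\<^bsub>B\<^esub> g \<in> F" if "f \<in> F" "g \<in> F" for f g
    using that N0_cl by (auto simp: F_def mult_sum_group)
  have inv: "inv\<^bsub>B\<^esub> f \<in> F" if "f \<in> F" for f
    using that N0_cl subsetD[OF FB that] by (auto simp: F_def inv_sum_group)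
  have one: "\<one>\<^bsub>B\<^esub> \<in> F" using N0_cl by (auto simp: F_def one_sum_group)
  have "subgroup (F \<times> Q0) W"
  proof (rule W.subgroupI)
    show "F \<times> Q0 \<subseteq> carrier W" using FB Q0_cl(1) by (auto simp: carrier_W)
    show "F \<times> Q0 \<noteq> {}" using one subgroup.one_closed[OF Q0(1)] by blast
  next
    fix x assume "x \<in> F \<times> Q0"
    then obtain f q where x: "x = (f, q)" "f \<in> F" "q \<in> Q0" by blast
    then show "inv\<^bsub>W\<^esub> x \<in> F \<times> Q0"
      using FB Q0_cl tr[OF Q0_cl(3) inv] by (auto simp: inv_W subset_iff)
  next
    fix x y assume "x \<in> F \<times> Q0" "y \<in> F \<times> Q0"
    then show "x \<otimes>\<^bsub>W\<^esub> y \<in> F \<times> Q0" using tr mult Q0_cl(2) by (auto simp: mult_W)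
  qed
  moreover have "S \<subseteq> F \<times> Q0"
  proof
    fix s assume s: "s \<in> S"
    have "snd s \<in> Q0" unfolding Q0_def using s by (intro generate.incl) auto
    have "A0 \<subseteq> A"
      using A0(1) subgroup.one_closed[OF Q0(1)] by (force simp: A_def)
    have "fst s p \<in> N0" if "p \<in> carrier Q" for p
    proof (cases "p \<in> A0")
      case True
      then show ?thesis unfolding N0_def using s by (intro generate.incl) force
    next
      case False
      then have "fst s p = \<one>\<^bsub>N\<^esub>" using s that by (auto simp: A0_def)
      then show ?thesis using N0_cl(3) by simp
    qed
    moreover have "fst s p = \<one>\<^bsub>N\<^esub>" if "p \<in> carrier Q" "p \<notin> A" for p
      using that s \<open>A0 \<subseteq> A\<close> by (auto simp: A0_def)
    ultimately have "fst s \<in> F" using S_cl(1)[OF s] by (auto simp: F_def B.mem_carrier)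
    with \<open>snd s \<in> Q0\<close> show "s \<in> F \<times> Q0" by (cases s) auto
  qed
  ultimately have "generate W S \<subseteq> F \<times> Q0" by (intro W.generate_subgroup_incl)
  then show "finite (generate W S)"
    by (rule finite_subset) (use finF Q0(2) in blast)
qed

lemma base_iso: "B \<cong> W\<lparr>carrier := carrier B \<times> {\<one>\<^bsub>Q\<^esub>}\<rparr>"
proof -
  have "(\<lambda>f. (f, \<one>\<^bsub>Q\<^esub>)) \<in> iso B (W\<lparr>carrier := carrier B \<times> {\<one>\<^bsub>Q\<^esub>}\<rparr>)"
    using group_hom.hom_mult[OF base_hom] by (auto simp: Group.iso_iff hom_def inj_on_def)
  then show ?thesis by (rule is_isoI)
qed

text \<open>A base element is determined by its finite graph over its support, and a countable set
  has only countably many finite subsets.\<close>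

lemma countable_wreath:
  assumes N: "countable (carrier N)" and Q: "countable (carrier Q)"
  shows "countable (carrier W)"
proof -
  let ?graph = "\<lambda>f. (\<lambda>p. (p, f p)) ` {p \<in> carrier Q. f p \<noteq> \<one>\<^bsub>N\<^esub>}"
  have "?graph ` carrier B \<subseteq> {A. A \<subseteq> carrier Q \<times> carrier N \<and> finite A}"
    by (auto simp: B.mem_carrier)
  moreover have "countable {A. A \<subseteq> carrier Q \<times> carrier N \<and> finite A}"
    using N Q by (simp add: countable_Collect_finite_subset conj_commute)
  ultimately have "countable (?graph ` carrier B)"
    by (rule countable_subset)
  moreover have "inj_on ?graph (carrier B)"
  proof (rule inj_onI)
    fix f g assume fg: "f \<in> carrier B" "g \<in> carrier B" "?graph f = ?graph g"
    have "f p = g p" if p: "p \<in> carrier Q" for p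
    proof -
      have "(p, x) \<in> ?graph f \<longleftrightarrow> (p, x) \<in> ?graph g" for x using fg(3) by simp
      then have "x = f p \<and> f p \<noteq> \<one>\<^bsub>N\<^esub> \<longleftrightarrow> x = g p \<and> g p \<noteq> \<one>\<^bsub>N\<^esub>" for x using p by auto
      then show ?thesis by metis
    qed
    then show "f = g"
      by (intro extensionalityI[of f "carrier Q" g]) (use fg(1,2) in \<open>auto simp: B.mem_carrier\<close>)
  qed
  ultimately have "countable (carrier B)" by (rule countable_image_inj_on)
  then show ?thesis using Q by (simp add: carrier_W)
qed

end

section \<open>Iterated wreath products and their sum\<close>

text \<open>When every label occurs countably infinitely often, the indexing no longer matters. Both
  final isomorphisms are instances of this absorption.\<close>

lemma sum_group_respecting_labels:
  assumes "countable I" "countable J" "\<And>l. group (H l)"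
    and "\<And>l. infinite {i \<in> I. a i = l}" "\<And>l. infinite {j \<in> J. b j = l}"
  shows "sum_group I (\<lambda>i. H (a i)) \<cong> sum_group J (\<lambda>j. H (b j))"
proof -
  obtain \<pi> where \<pi>: "bij_betw \<pi> I J" "\<And>i. i \<in> I \<Longrightarrow> b (\<pi> i) = a i"
    using bij_betw_respecting_labels[OF assms(1,2,4,5)] by blast
  have "sum_group I (\<lambda>i. H (a i)) \<cong> sum_group I (\<lambda>i. H (b (\<pi> i)))"
    by (rule iso_sum_groupI) (use assms(3) \<pi>(2) in auto)
  also have "\<dots> \<cong> sum_group J (\<lambda>j. H (b j))"
    by (rule sum_group_reindex[OF \<pi>(1)]) (rule assms(3))
  finally show ?thesis .
qed

text \<open>Collects what is needed of a copy of the wreath product on the natural numbers. The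
  quotient by the pseudocentre is given as a surjection with that kernel, to fit
  \<open>sum_group_Mod_pseudocentre\<close>.\<close>

definition wreath_like :: "nat monoid \<Rightarrow> nat monoid \<Rightarrow> nat monoid \<Rightarrow> bool" where
  "wreath_like N Q W \<longleftrightarrow> group W \<and> perfect W \<and> infinite (carrier W) \<and>
    W\<lparr>carrier := pseudocentre W\<rparr> \<cong> sum_group (carrier Q) (\<lambda>_. N) \<and>
    (\<exists>\<phi>\<in>hom W Q. \<phi> ` carrier W = carrier Q \<and> kernel W Q \<phi> = pseudocentre W) \<and>
    (torsion_free N \<and> torsion_free Q \<longrightarrow> torsion_free W) \<and>
    (locally_finite N \<and> locally_finite Q \<longrightarrow> locally_finite W)"

lemma ex_wreath_like:
  assumes N: "group N" "perfect N" "infinite (carrier N)"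
    and Q: "group Q" "perfect Q" "infinite (carrier Q)"
  shows "\<exists>W. wreath_like N Q W"
proof -
  interpret wreath_product N Q by (intro wreath_product.intro N(1) Q(1))
  have "countable (carrier W)" by (rule countable_wreath) auto
  then obtain V :: "nat monoid" and h where V: "group_iso W V h"
    using W.countable_group_iso_nat by blast
  interpret h: group_iso W V h by (rule V)
  have "\<not> carrier N \<subseteq> {\<one>\<^bsub>N\<^esub>}" using N(3) by (meson finite.emptyI finite.insertI finite_subset)
  then obtain n where "n \<in> carrier N" "n \<noteq> \<one>\<^bsub>N\<^esub>" by blast
  then have P: "pseudocentre W = carrier B \<times> {\<one>\<^bsub>Q\<^esub>}" by (rule pseudocentre_wreath[OF N(2) _ _ Q(3)])
  have sub: "subgroup (pseudocentre W) W" using W.pseudocentre_normal by (rule normal_imp_subgroup)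
  have "infinite (carrier W)"
    using Q(3) B.S.one_closed unfolding carrier_W by (auto simp: finite_cartesian_product_iff)
  then have "infinite (carrier V)" by (rule h.infinite_image)
  moreover have "perfect V" using perfect_wreath[OF N(2) Q(2)] by (rule h.perfect_image)
  moreover have "V\<lparr>carrier := pseudocentre V\<rparr> \<cong> B"
  proof -
    have "W\<lparr>carrier := pseudocentre W\<rparr> \<cong> V\<lparr>carrier := pseudocentre V\<rparr>"
      using iso_restrict[OF h.iso W.is_group h.H.is_group sub] h.pseudocentre_image is_isoI by metis
    then have "V\<lparr>carrier := pseudocentre V\<rparr> \<cong> W\<lparr>carrier := pseudocentre W\<rparr>"
      by (rule group.iso_sym[OF W.subgroup_imp_group[OF sub]])
    also have "\<dots> \<cong> B"
      unfolding P by (rule B.S.iso_sym[OF base_iso])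
    finally show ?thesis .
  qed
  moreover have "\<exists>\<phi>\<in>hom V Q. \<phi> ` carrier V = carrier Q \<and> kernel V Q \<phi> = pseudocentre V"
  proof (intro bexI conjI)
    let ?g = "inv_into (carrier W) h"
    interpret g: group_iso V W ?g by (rule h.group_iso_inv)
    interpret top: group_hom W Q snd by (rule top_hom)
    show "snd \<circ> ?g \<in> hom V Q" by (rule hom_compose[OF g.homh top.homh])
    have "snd ` carrier W = carrier Q"
      using B.S.one_closed unfolding carrier_W by (auto simp: image_iff)
    then show "(snd \<circ> ?g) ` carrier V = carrier Q" using g.img by (metis image_comp)
    have gh: "?g (h x) = x" if "x \<in> carrier W" for x using that h.inj by simp
    have hg: "h (?g y) = y" if "y \<in> carrier V" for y using that h.img by (simp add: f_inv_into_f)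
    have "kernel V Q (snd \<circ> ?g) = {y \<in> carrier V. ?g y \<in> kernel W Q snd}"
      unfolding kernel_def comp_def using g.hom_closed by blast
    also have "\<dots> = h ` kernel W Q snd"
    proof
      show "h ` kernel W Q snd \<subseteq> {y \<in> carrier V. ?g y \<in> kernel W Q snd}"
        using gh h.hom_closed unfolding kernel_def by fastforce
      show "{y \<in> carrier V. ?g y \<in> kernel W Q snd} \<subseteq> h ` kernel W Q snd"
        using hg by (metis (no_types, lifting) imageI mem_Collect_eq subsetI)
    qed
    finally show "kernel V Q (snd \<circ> ?g) = pseudocentre V"
      by (simp add: kernel_top P h.pseudocentre_image)
  qed
  ultimately have "wreath_like N Q V"
    unfolding wreath_like_def
    using h.H.is_group h.torsion_free_image h.locally_finite_image torsion_free_wreath locally_finite_wreath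
    by blast
  then show ?thesis by blast
qed

section \<open>Iterated wreath products indexed by binary trees\<close>

definition nat_wreath :: "nat monoid \<Rightarrow> nat monoid \<Rightarrow> nat monoid" where
  "nat_wreath N Q = (SOME W. wreath_like N Q W)"

text \<open>A shape records how a group is built: a leaf is the initial group, and
  \<open>Node s t\<close> is the wreath product with base factor \<open>s\<close> and top
  \<open>t\<close>.\<close>

datatype shape = Leaf | Node shape shape

instance shape :: countable
  by countable_datatype

text \<open>The shape of the groups making up the pseudocentre; \<open>left Leaf = Leaf\<close>
  reflects that the initial group is its own pseudocentre.\<close>

fun left :: "shape \<Rightarrow> shape" where
  "left Leaf = Leaf"
| "left (Node s t) = s"

fun right :: "shape \<Rightarrow> shape" where
  "right Leaf = Leaf"
| "right (Node s t) = t"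

text \<open>Reading \<open>n\<close> as a pair whose first entry encodes a shape makes every shape
  the label of infinitely many \<open>n\<close>.\<close>

definition label :: "nat \<Rightarrow> shape" where
  "label n = from_nat (fst (prod_decode n))"

lemma infinite_label: "infinite {n. label n = t}"
proof -
  have "(\<lambda>k. prod_encode (to_nat t, k)) ` UNIV \<subseteq> {n. label n = t}"
    by (auto simp: label_def)
  moreover have "inj (\<lambda>k. prod_encode (to_nat t, k))" by (auto simp: inj_on_def)
  ultimately show ?thesis by (meson finite_subset finite_imageD infinite_UNIV_nat)
qed

lemma infinite_label_vimage:
  assumes "\<And>n. label n = t \<Longrightarrow> P n" shows "infinite {n. P n}"
proof -
  have "{n. label n = t} \<subseteq> {n. P n}" using assms by blast
  then show ?thesis using infinite_label by (rule infinite_super)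
qed

primrec iterated_wreath :: "nat monoid \<Rightarrow> shape \<Rightarrow> nat monoid" where
  "iterated_wreath T Leaf = T"
| "iterated_wreath T (Node s t) = nat_wreath (iterated_wreath T s) (iterated_wreath T t)"

locale perfect_leaf = group T for T :: "nat monoid" +
  assumes perfect: "perfect T" and infinite: "infinite (carrier T)"
    and pseudocentre: "pseudocentre T = carrier T"
begin

abbreviation H where "H \<equiv> iterated_wreath T"

text \<open>The three properties go through the induction together, because the wreath product
  construction requires all of them of both factors.\<close>

lemma H_props: "group (H t) \<and> perfect (H t) \<and> infinite (carrier (H t))"
proof (induction t)
  case Leaf
  then show ?case by (simp add: perfect infinite is_group)
next
  case (Node s t)
  then have "wreath_like (H s) (H t) (H (Node s t))"
    using ex_wreath_like[of "H s" "H t"] by (simp add: nat_wreath_def someI_ex)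
  then show ?case by (simp add: wreath_like_def)
qed

lemma H_Node: "wreath_like (H s) (H t) (H (Node s t))"
  using ex_wreath_like[of "H s" "H t"] H_props by (simp add: nat_wreath_def someI_ex)

lemma torsion_free_H: "torsion_free T \<Longrightarrow> torsion_free (H t)"
proof (induction t)
  case (Node s t)
  then show ?case using H_Node[of s t] unfolding wreath_like_def by blast
qed simp

lemma locally_finite_H: "locally_finite T \<Longrightarrow> locally_finite (H t)"
proof (induction t)
  case (Node s t)
  then show ?case using H_Node[of s t] unfolding wreath_like_def by blast
qed simp

section \<open>The direct sum of all iterates\<close>

definition G :: "(nat \<Rightarrow> nat) monoid" where
  "G = sum_group UNIV (\<lambda>n. H (label n))"

sublocale G: group_family UNIV "\<lambda>n. H (label n)"
  by (rule group_family.intro) (simp add: H_props)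

text \<open>Indexes the copies of \<open>H (left t)\<close> whose direct sum is the pseudocentre of
  \<open>H t\<close>: a single one for a leaf, one per element of the top group for a node.\<close>

fun fibre :: "shape \<Rightarrow> nat set" where
  "fibre Leaf = {0}"
| "fibre (Node s t) = carrier (H t)"

lemma pseudocentre_H: "(H t)\<lparr>carrier := pseudocentre (H t)\<rparr> \<cong> sum_group (fibre t) (\<lambda>_. H (left t))"
proof (cases t)
  case Leaf
  then show ?thesis using sum_group_singleton[OF is_group] by (simp add: pseudocentre)
next
  case (Node s t)
  then show ?thesis using H_Node[of s t] by (simp add: wreath_like_def)
qed

lemma fibre_nonempty: "fibre t \<noteq> {}"
proof (cases t)
  case (Node s r)
  then show ?thesis using H_props[of r] infinite_imp_nonempty by auto
qed simp

text \<open>The pseudocentre is a sum of sums, flattened to a sum of groups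
  \<open>H (left (label n))\<close>. Every shape \<open>t\<close> appears infinitely often among
  them, as the base of \<open>Node t Leaf\<close>.\<close>

lemma pseudocentre_G_iso: "G\<lparr>carrier := pseudocentre G\<rparr> \<cong> G"
proof -
  have sub: "subgroup (pseudocentre (H t)) (H t)" for t
    using group.pseudocentre_normal H_props normal_imp_subgroup by blast
  have grp: "group ((H t)\<lparr>carrier := pseudocentre (H t)\<rparr>)" for t
    using sub H_props group.subgroup_imp_group by blast
  have "G\<lparr>carrier := pseudocentre G\<rparr> = sum_group UNIV (\<lambda>n. (H (label n))\<lparr>carrier := pseudocentre (H (label n))\<rparr>)"
    unfolding G_def by (rule G.sum_group_pseudocentre_eq)
  also have "\<dots> \<cong> sum_group UNIV (\<lambda>n. sum_group (fibre (label n)) (\<lambda>_. H (left (label n))))"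
    by (rule iso_sum_groupI) (use pseudocentre_H grp H_props in auto)
  also have "\<dots> \<cong> sum_group (SIGMA n:UNIV. fibre (label n)) (\<lambda>(n, _). H (left (label n)))"
    by (rule sum_group_Sigma) (simp add: H_props)
  also have "\<dots> = sum_group (SIGMA n:UNIV. fibre (label n)) (\<lambda>p. H (left (label (fst p))))"
    by (simp add: case_prod_unfold)
  also have "\<dots> \<cong> sum_group UNIV (\<lambda>n. H (label n))"
  proof (rule sum_group_respecting_labels[where H = H and b = label])
    fix t
    let ?S = "{p \<in> SIGMA n:UNIV. fibre (label n). left (label (fst p)) = t}"
    \<comment> \<open>Nonempty fibres guarantee that each \<open>n\<close> with the right label
      contributes at least one index.\<close>
    have "fst ` ?S = {n. left (label n) = t}"
      using fibre_nonempty by (force simp: image_iff)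
    then have "infinite (fst ` ?S)"
      by (simp add: infinite_label_vimage[of "Node t Leaf"])
    then show "infinite ?S" by (rule contrapos_nn) (rule finite_imageI)
  qed (use H_props infinite_label in auto)
  finally show ?thesis by (simp add: G_def)
qed

text \<open>Leaves vanish in the quotient and a node leaves its top group. Every shape
  \<open>t\<close> still occurs infinitely often, as the top of \<open>Node Leaf t\<close>.\<close>

lemma G_Mod_pseudocentre_iso: "G Mod pseudocentre G \<cong> G"
proof -
  define J where "J = {n. label n \<noteq> Leaf}"
  have "\<exists>\<phi>\<in>hom (H t) (H (right t)). \<phi> ` carrier (H t) = carrier (H (right t)) \<and>
      kernel (H t) (H (right t)) \<phi> = pseudocentre (H t)" if "t \<noteq> Leaf" for t
    using that H_Node unfolding wreath_like_def by (cases t) auto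
  then obtain \<phi> where \<phi>: "\<And>t. t \<noteq> Leaf \<Longrightarrow> \<phi> t \<in> hom (H t) (H (right t))"
    "\<And>t. t \<noteq> Leaf \<Longrightarrow> \<phi> t ` carrier (H t) = carrier (H (right t))"
    "\<And>t. t \<noteq> Leaf \<Longrightarrow> kernel (H t) (H (right t)) (\<phi> t) = pseudocentre (H t)"
    by metis
  have "G Mod pseudocentre G \<cong> sum_group J (\<lambda>n. H (right (label n)))"
    unfolding G_def
    by (rule G.sum_group_Mod_pseudocentre[where \<phi> = "\<lambda>n. \<phi> (label n)"])
      (use \<phi> H_props pseudocentre in \<open>auto simp: J_def\<close>)
  also have "\<dots> \<cong> sum_group UNIV (\<lambda>n. H (label n))"
  proof (rule sum_group_respecting_labels[where H = H and b = label])
    fix t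
    show "infinite {n \<in> J. right (label n) = t}"
      unfolding J_def mem_Collect_eq by (rule infinite_label_vimage[of "Node Leaf t"]) simp
  qed (use H_props infinite_label in auto)
  finally show ?thesis by (simp add: G_def)
qed

text \<open>A coordinate labelled \<open>Node Leaf Leaf\<close> has the nontrivial quotient
  \<open>T\<close>, so some element supported there is missed.\<close>

lemma pseudocentre_G_proper: "pseudocentre G \<subset> carrier G"
proof -
  obtain n where n: "label n = Node Leaf Leaf"
    using infinite_label[of "Node Leaf Leaf"] by (metis (mono_tags, lifting) Collect_empty_eq finite.emptyI)
  obtain \<phi> where \<phi>: "\<phi> ` carrier (H (label n)) = carrier T"
    "kernel (H (label n)) T \<phi> = pseudocentre (H (label n))"
    using H_Node[of Leaf Leaf] unfolding wreath_like_def n by auto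
  have "\<not> carrier T \<subseteq> {\<one>\<^bsub>T\<^esub>}" using infinite by (meson finite.emptyI finite.insertI finite_subset)
  then obtain y where "y \<in> carrier T" "y \<noteq> \<one>\<^bsub>T\<^esub>" by blast
  then obtain x where x: "x \<in> carrier (H (label n))" "\<phi> x \<noteq> \<one>\<^bsub>T\<^esub>"
    using \<phi>(1) by (metis imageE)
  then have "x \<notin> pseudocentre (H (label n))" unfolding \<phi>(2)[symmetric] by (simp add: kernel_def)
  then have "single UNIV (\<lambda>n. H (label n)) n x \<notin> pseudocentre G"
    unfolding G_def G.pseudocentre_sum_group by (auto simp: single_def)
  moreover have "single UNIV (\<lambda>n. H (label n)) n x \<in> carrier G"
    unfolding G_def using x(1) by (intro G.single_closed) auto
  ultimately show ?thesis
    using G.S.pseudocentre_subset unfolding G_def by blast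
qed

lemma ex_group_iso_pseudocentre_and_quotient:
  "\<exists>G :: (nat \<Rightarrow> nat) monoid. group G \<and> pseudocentre G \<subset> carrier G \<and>
    G\<lparr>carrier := pseudocentre G\<rparr> \<cong> G \<and> G Mod pseudocentre G \<cong> G \<and>
    (torsion_free T \<longrightarrow> torsion_free G) \<and> (locally_finite T \<longrightarrow> locally_finite G)"
proof (intro exI[of _ G] conjI impI)
  show "group G" unfolding G_def by (rule G.S.is_group)
  show "torsion_free G" if "torsion_free T"
    unfolding G_def by (rule G.torsion_free_sum_group) (rule torsion_free_H[OF that])
  show "locally_finite G" if "locally_finite T"
    unfolding G_def by (rule G.locally_finite_sum_group) (rule locally_finite_H[OF that])
qed (rule pseudocentre_G_proper pseudocentre_G_iso G_Mod_pseudocentre_iso)+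

end

lemma ex_group_if_displaceable:
  assumes D: "group D" "displaceable D" "countable (carrier D)"
    and ab: "a \<in> carrier D" "b \<in> carrier D" "a \<otimes>\<^bsub>D\<^esub> b \<noteq> b \<otimes>\<^bsub>D\<^esub> a"
  shows "\<exists>G :: (nat \<Rightarrow> nat) monoid. group G \<and> pseudocentre G \<subset> carrier G \<and>
    G\<lparr>carrier := pseudocentre G\<rparr> \<cong> G \<and> G Mod pseudocentre G \<cong> G \<and>
    (torsion_free D \<longrightarrow> torsion_free G) \<and> (locally_finite D \<longrightarrow> locally_finite G)"
proof -
  interpret D: group D by (rule D(1))
  let ?T = "D\<lparr>carrier := derived D (carrier D)\<rparr>"
  have sub: "subgroup (derived D (carrier D)) D" by (simp add: D.derived_is_subgroup)
  interpret T: group ?T by (rule D.subgroup_imp_group[OF sub])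
  have "countable (carrier ?T)"
    using D(3) D.derived_in_carrier by (auto intro: countable_subset)
  then obtain T :: "nat monoid" and h where "group_iso ?T T h"
    using T.countable_group_iso_nat by blast
  then interpret h: group_iso ?T T h .
  interpret perfect_leaf T
  proof
    show "perfect T" using D.perfect_derived[OF D(2)] by (rule h.perfect_image)
    show "infinite (carrier T)" using h.infinite_image D.infinite_derived[OF D(2) ab] by simp
    show "pseudocentre T = carrier T"
      using D.pseudocentre_derived[OF D(2)] h.pseudocentre_image h.img by simp
  qed
  show ?thesis
    using ex_group_iso_pseudocentre_and_quotient h.torsion_free_image h.locally_finite_image
      torsion_free_subgroup[OF D(1) sub] locally_finite_subgroup[OF D(1) sub]
    by blast
qed

section \<open>Displaceable groups of bijections\<close>

text \<open>The generated subgroup consists of products of words over the generators and their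
  inverses.\<close>

lemma (in group) countable_generate:
  assumes S: "countable S" "S \<subseteq> carrier G"
  shows "countable (generate G S)"
proof -
  define U where "U = S \<union> m_inv G ` S"
  have U: "U \<subseteq> carrier G" "countable U" using S by (auto simp: U_def)
  let ?p = "\<lambda>xs. foldr (\<otimes>) xs \<one>"
  have closed: "?p xs \<in> carrier G" if "xs \<in> lists U" for xs
    using that U(1) by (induction xs) auto
  have append: "?p (xs @ ys) = ?p xs \<otimes> ?p ys" if "xs \<in> lists U" "ys \<in> lists U" for xs ys
    using that U(1) closed by (induction xs) (auto simp: m_assoc subset_iff)
  have "generate G S \<subseteq> ?p ` lists U"
  proof
    fix x assume "x \<in> generate G S"
    then show "x \<in> ?p ` lists U"
    proof (induction rule: generate.induct)
      case one
      show ?case by (rule image_eqI[of _ _ "[]"]) auto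
    next
      case (incl s)
      show ?case by (rule image_eqI[of _ _ "[s]"]) (use incl S(2) in \<open>auto simp: U_def\<close>)
    next
      case (inv s)
      show ?case by (rule image_eqI[of _ _ "[inv s]"]) (use inv S(2) in \<open>auto simp: U_def\<close>)
    next
      case (eng x y)
      then obtain xs ys where "xs \<in> lists U" "ys \<in> lists U" "x = ?p xs" "y = ?p ys" by blast
      then show ?case by (intro image_eqI[of _ _ "xs @ ys"]) (auto simp: append simp del: foldr_append)
    qed
  qed
  then show ?thesis using U(2) by (meson countable_image countable_lists countable_subset)
qed

definition perm_group :: "('a \<Rightarrow> 'a) monoid" where
  "perm_group = \<lparr>carrier = {f. bij f}, monoid.mult = (\<circ>), one = id\<rparr>"

lemma perm_group_simps [simp]:
  "carrier perm_group = {f. bij f}" "f \<otimes>\<^bsub>perm_group\<^esub> g = f \<circ> g" "\<one>\<^bsub>perm_group\<^esub> = id"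
  by (simp_all add: perm_group_def)

interpretation perm: group perm_group
proof (rule groupI)
  fix f :: "'a \<Rightarrow> 'a" assume "f \<in> carrier perm_group"
  then show "\<exists>g\<in>carrier perm_group. g \<otimes>\<^bsub>perm_group\<^esub> f = \<one>\<^bsub>perm_group\<^esub>"
    by (intro bexI[of _ "inv_into UNIV f"]) (auto simp: bij_imp_bij_inv bij_is_inj)
qed (auto intro: bij_comp)

lemma inv_perm_group: "bij f \<Longrightarrow> inv\<^bsub>perm_group\<^esub> f = inv_into UNIV f"
  by (rule perm.inv_equality) (auto simp: bij_imp_bij_inv bij_is_inj)

lemma pow_perm_group: "f [^]\<^bsub>perm_group\<^esub> (n :: nat) = f ^^ n"
  by (induction n) (simp_all add: funpow_swap1 fun_eq_iff)

text \<open>An injective map sends moved points to moved points, so a point moved by one map and its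
  image are both fixed by the other.\<close>

lemma commute_if_disjoint_supports:
  assumes "inj f" "inj g" "\<And>x. f x = x \<or> g x = x"
  shows "f \<circ> g = g \<circ> f"
proof
  fix x
  show "(f \<circ> g) x = (g \<circ> f) x"
    using assms(3)[of x] assms(3)[of "f x"] assms(3)[of "g x"] injD[OF assms(1)] injD[OF assms(2)]
    by (metis comp_apply)
qed

text \<open>The sets \<open>A n\<close> play the role of bounded sets. Each \<open>h n\<close> moves
  \<open>A n\<close> off itself while being supported in some larger \<open>A m\<close>, so the
  generated group has only boundedly supported elements.\<close>

locale displacing_bijections =
  fixes h :: "nat \<Rightarrow> 'a \<Rightarrow> 'a" and A :: "nat \<Rightarrow> 'a set"
  assumes bij_h: "bij (h n)"
    and mono_A: "m \<le> n \<Longrightarrow> A m \<subseteq> A n"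
    and nonempty: "A 0 \<noteq> {}"
    and displaces: "x \<in> A n \<Longrightarrow> h n x \<notin> A n"
    and bounded: "\<exists>m. \<forall>x. x \<notin> A m \<longrightarrow> h n x = x"
begin

abbreviation S where "S \<equiv> generate perm_group (range h)"

lemma sub: "subgroup S perm_group"
  by (rule perm.generate_is_subgroup) (auto simp: bij_h)

definition D where "D = perm_group\<lparr>carrier := S\<rparr>"

lemma D_simps: "carrier D = S" "f \<otimes>\<^bsub>D\<^esub> g = f \<circ> g" "\<one>\<^bsub>D\<^esub> = id"
  by (simp_all add: D_def)

sublocale D: group D
  unfolding D_def by (rule perm.subgroup_imp_group[OF sub])

lemma S_induct [consumes 1, case_names id gen inv comp]:
  assumes "f \<in> S" "P id" "\<And>n. P (h n)" "\<And>f. bij f \<Longrightarrow> P f \<Longrightarrow> P (inv_into UNIV f)"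
    "\<And>f g. bij f \<Longrightarrow> bij g \<Longrightarrow> P f \<Longrightarrow> P g \<Longrightarrow> P (f \<circ> g)"
  shows "P f"
proof -
  have "subgroup {f. bij f \<and> P f} perm_group"
    using assms(2,4,5)
    by (intro perm.subgroupI) (auto simp: inv_perm_group bij_imp_bij_inv intro: bij_comp)
  then have "S \<subseteq> {f. bij f \<and> P f}"
    by (rule perm.generate_subgroup_incl[rotated]) (use assms(3) bij_h in auto)
  with assms(1) show ?thesis by blast
qed

lemma S_bij: "f \<in> S \<Longrightarrow> bij f"
  using subgroup.subset[OF sub] by auto

lemma inv_D: "f \<in> S \<Longrightarrow> inv\<^bsub>D\<^esub> f = inv_into UNIV f"
  unfolding D_def using perm.m_inv_consistent[OF sub] S_bij by (simp add: inv_perm_group)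

lemma S_bounded: "f \<in> S \<Longrightarrow> \<exists>m. \<forall>x. x \<notin> A m \<longrightarrow> f x = x"
proof (induction rule: S_induct)
  case (gen n)
  show ?case by (rule bounded)
next
  case (inv f)
  then obtain m where "\<forall>x. x \<notin> A m \<longrightarrow> f x = x" by blast
  then show ?case using inv(1) by (metis bij_is_inj inv_f_f)
next
  case (comp f g)
  then obtain k m where "\<forall>x. x \<notin> A k \<longrightarrow> f x = x" "\<forall>x. x \<notin> A m \<longrightarrow> g x = x" by blast
  moreover have "A k \<subseteq> A (max k m)" "A m \<subseteq> A (max k m)" by (simp_all add: mono_A)
  ultimately have "\<forall>x. x \<notin> A (max k m) \<longrightarrow> (f \<circ> g) x = x"
    by (metis comp_apply subsetD)
  then show ?case by blast
qed simp

lemma finite_S_bounded: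
  assumes "finite F" "F \<subseteq> S"
  obtains m where "\<And>f x. f \<in> F \<Longrightarrow> x \<notin> A m \<Longrightarrow> f x = x"
proof -
  have "\<exists>m. \<forall>f\<in>F. \<forall>x. x \<notin> A m \<longrightarrow> f x = x"
    using assms
  proof (induction F)
    case (insert f F)
    then obtain k m where "\<forall>x. x \<notin> A k \<longrightarrow> f x = x" "\<forall>f\<in>F. \<forall>x. x \<notin> A m \<longrightarrow> f x = x"
      using S_bounded by blast
    moreover have "A k \<subseteq> A (max k m)" "A m \<subseteq> A (max k m)" by (simp_all add: mono_A)
    ultimately have "\<forall>g\<in>insert f F. \<forall>x. x \<notin> A (max k m) \<longrightarrow> g x = x" by blast
    then show ?case by blast
  qed simp
  then show thesis using that by blast
qed

lemma h_mem: "h n \<in> S"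
  by (intro generate.incl) simp

text \<open>Finitely many elements are supported in a common \<open>A m\<close>; conjugation by
  \<open>h m\<close> moves these supports off \<open>A m\<close>, and maps with disjoint supports
  commute.\<close>

lemma displaceable_D: "displaceable D"
  unfolding displaceable_def
proof (intro allI impI)
  fix F assume "finite F \<and> F \<subseteq> carrier D"
  then have F: "finite F" "F \<subseteq> S" by (auto simp: D_simps)
  then obtain m where m: "\<And>f x. f \<in> F \<Longrightarrow> x \<notin> A m \<Longrightarrow> f x = x" by (rule finite_S_bounded) blast
  have "(h m \<circ> f \<circ> inv_into UNIV (h m)) \<circ> g = g \<circ> (h m \<circ> f \<circ> inv_into UNIV (h m))" if fg: "f \<in> F" "g \<in> F" for f g
  proof (rule commute_if_disjoint_supports)
    have bij: "bij f" "bij g" using fg F S_bij by auto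
    then show "inj (h m \<circ> f \<circ> inv_into UNIV (h m))" "inj g"
      using bij_h[of m] by (auto intro!: bij_is_inj bij_comp bij_imp_bij_inv)
    fix x
    show "(h m \<circ> f \<circ> inv_into UNIV (h m)) x = x \<or> g x = x"
    proof (cases "x \<in> A m")
      case True
      have "h m (inv_into UNIV (h m) x) = x" using bij_h by (simp add: bij_is_surj surj_f_inv_f)
      then have "inv_into UNIV (h m) x \<notin> A m" using True displaces by metis
      then show ?thesis using m[OF fg(1)] \<open>h m (inv_into UNIV (h m) x) = x\<close> by simp
    next
      case False
      then show ?thesis using m[OF fg(2)] by simp
    qed
  qed
  then show "\<exists>k\<in>carrier D. \<forall>x\<in>F. \<forall>y\<in>F.
      k \<otimes>\<^bsub>D\<^esub> x \<otimes>\<^bsub>D\<^esub> inv\<^bsub>D\<^esub> k \<otimes>\<^bsub>D\<^esub> y = y \<otimes>\<^bsub>D\<^esub> (k \<otimes>\<^bsub>D\<^esub> x \<otimes>\<^bsub>D\<^esub> inv\<^bsub>D\<^esub> k)"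
    using h_mem by (intro bexI[of _ "h m"]) (auto simp: D_simps inv_D)
qed

lemma countable_D: "countable (carrier D)"
  unfolding D_simps by (rule perm.countable_generate) (auto simp: bij_h)

text \<open>Take \<open>m\<close> such that \<open>h 0\<close> is supported in \<open>A m\<close>,
  and \<open>p\<close> moved by \<open>h 0\<close>. Then \<open>h m\<close> sends \<open>p\<close>
  outside \<open>A m\<close>, where \<open>h 0\<close> is the identity.\<close>

lemma noncommuting_D: "\<exists>a\<in>carrier D. \<exists>b\<in>carrier D. a \<otimes>\<^bsub>D\<^esub> b \<noteq> b \<otimes>\<^bsub>D\<^esub> a"
proof -
  obtain p where p: "p \<in> A 0" using nonempty by blast
  obtain m where m: "\<And>x. x \<notin> A m \<Longrightarrow> h 0 x = x" using bounded by blast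
  have "h 0 p \<noteq> p" using displaces[OF p] p by metis
  then have "p \<in> A m" using m by blast
  then have "h 0 (h m p) = h m p" using displaces m by blast
  moreover have "h m (h 0 p) \<noteq> h m p" using \<open>h 0 p \<noteq> p\<close> bij_h by (meson bij_is_inj injD)
  ultimately have "h 0 \<circ> h m \<noteq> h m \<circ> h 0" by (metis comp_apply)
  then show ?thesis using h_mem unfolding D_simps by blast
qed

lemma ex_group:
  "\<exists>G :: (nat \<Rightarrow> nat) monoid. group G \<and> pseudocentre G \<subset> carrier G \<and>
    G\<lparr>carrier := pseudocentre G\<rparr> \<cong> G \<and> G Mod pseudocentre G \<cong> G \<and>
    (torsion_free D \<longrightarrow> torsion_free G) \<and> (locally_finite D \<longrightarrow> locally_finite G)"
  using noncommuting_D ex_group_if_displaceable[OF D.is_group displaceable_D countable_D] by blast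

text \<open>A finite set of elements generates a group of permutations of one finite set
  \<open>A m\<close>.\<close>

lemma locally_finite_D:
  assumes "\<And>n. finite (A n)" shows "locally_finite D"
  unfolding locally_finite_def
proof (intro allI impI)
  fix F assume "finite F \<and> F \<subseteq> carrier D"
  then have F: "finite F" "F \<subseteq> S" by (auto simp: D_simps)
  then obtain m where m: "\<And>f x. f \<in> F \<Longrightarrow> x \<notin> A m \<Longrightarrow> f x = x" by (rule finite_S_bounded) blast
  let ?K = "{f. f permutes A m}"
  have K: "?K = {f. bij f \<and> (\<forall>x. x \<notin> A m \<longrightarrow> f x = x)}"
    by (auto simp: permutes_def bij_iff)
  have "subgroup ?K perm_group"
    by (rule perm.subgroupI)
      (auto simp: permutes_bij inv_perm_group permutes_inv permutes_compose intro: permutes_id)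
  moreover have "F \<subseteq> ?K" unfolding K using m F(2) S_bij by blast
  ultimately have "generate perm_group F \<subseteq> ?K" by (rule perm.generate_subgroup_incl[rotated])
  moreover have "generate D F = generate perm_group F"
    unfolding D_def by (rule perm.generate_consistent[OF F(2) sub])
  ultimately show "finite (generate D F)"
    using finite_permutations[OF assms[of m]] finite_subset by metis
qed

end

section \<open>The torsion-free instance: order automorphisms of the rationals\<close>

text \<open>A point moved upwards moves further up under iteration, likewise downwards, so it never
  returns.\<close>

lemma strict_mono_funpow_eq_id:
  fixes f :: "'a :: linorder \<Rightarrow> 'a"
  assumes f: "strict_mono f" and n: "n > 0" "f ^^ n = id"
  shows "f = id"
proof -
  have up: "x < (f ^^ Suc k) x" if "x < f x" for x k
  proof (induction k)
    case (Suc k)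
    have "f x < f ((f ^^ Suc k) x)" using f Suc by (rule strict_monoD)
    with that show ?case by simp
  qed (use that in simp)
  have down: "(f ^^ Suc k) x < x" if "f x < x" for x k
  proof (induction k)
    case (Suc k)
    have "f ((f ^^ Suc k) x) < f x" using f Suc by (rule strict_monoD)
    with that show ?case by simp
  qed (use that in simp)
  obtain k where "n = Suc k" using n(1) gr0_implies_Suc by blast
  then have "(f ^^ Suc k) x = x" for x using n(2) by simp
  then have "f x = x" for x using up[of x k] down[of x k] by (metis less_irrefl linorder_neqE)
  then show ?thesis by auto
qed

lemma strict_mono_max_min:
  fixes f g :: "'a :: linorder \<Rightarrow> 'b :: linorder"
  assumes "strict_mono f" "strict_mono g"
  shows "strict_mono (\<lambda>x. max (f x) (g x))" "strict_mono (\<lambda>x. min (f x) (g x))"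
  using assms by (auto simp: strict_mono_def less_max_iff_disj min_less_iff_disj) (meson leI le_less_trans less_trans)

lemma surj_max_min:
  fixes f g :: "'a :: linorder \<Rightarrow> 'b :: linorder"
  assumes "strict_mono f" "strict_mono g" "surj f" "surj g"
  shows "surj (\<lambda>x. max (f x) (g x))" "surj (\<lambda>x. min (f x) (g x))"
proof -
  have *: "\<exists>x. max (f x) (g x) = y" "\<exists>x. min (f x) (g x) = y" for y
  proof -
    obtain a b where ab: "f a = y" "g b = y" using assms(3,4) by (metis surjD)
    \<comment> \<open>At \<open>min a b\<close> one of the two functions takes the value
      \<open>y\<close> and the other is at most \<open>y\<close>, so their maximum is
      \<open>y\<close>; dually for the minimum at \<open>max a b\<close>.\<close>
    have "f (min a b) \<le> f a" "g (min a b) \<le> g b" "f a \<le> f (max a b)" "g b \<le> g (max a b)"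
      using assms(1,2) by (auto simp: strict_mono_less_eq)
    then show "\<exists>x. max (f x) (g x) = y" "\<exists>x. min (f x) (g x) = y"
      using ab by (metis max.absorb2 max.absorb1 min_def, metis min.absorb2 min.absorb1 max_def)
  qed
  then show "surj (\<lambda>x. max (f x) (g x))" "surj (\<lambda>x. min (f x) (g x))"
    unfolding surj_def by metis+
qed

text \<open>The piecewise linear bump supported in \<open>(-c, c)\<close> with slopes \<open>k\<close> and \<open>1/k\<close>, where
  \<open>k = 2 * c - 1\<close> is just steep enough to move \<open>(- (c - 1), c - 1)\<close> off itself.\<close>

definition bump :: "rat \<Rightarrow> rat \<Rightarrow> rat" where
  "bump c x = max x (min ((2 * c - 1) * (x + c) - c) ((x - c) / (2 * c - 1) + c))"

lemma bump:
  assumes "c > 1"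
  shows "strict_mono (bump c)" "bij (bump c)"
proof -
  let ?k = "2 * c - 1"
  have k: "?k > 0" using assms by simp
  have 1: "strict_mono (\<lambda>x. ?k * (x + c) - c)" "strict_mono (\<lambda>x. (x - c) / ?k + c)"
    "strict_mono (\<lambda>x :: rat. x)"
    using k by (auto simp: strict_mono_def divide_strict_right_mono)
  have "\<exists>x. y = ?k * (x + c) - c" "\<exists>x. y = (x - c) / ?k + c" for y
    using k by (auto intro: exI[of _ "(y + c) / ?k - c"] exI[of _ "?k * (y - c) + c"])
  then have 2: "surj (\<lambda>x. ?k * (x + c) - c)" "surj (\<lambda>x. (x - c) / ?k + c)" "surj (\<lambda>x :: rat. x)"
    by (auto simp: surj_def)
  note 3 = strict_mono_max_min(2)[OF 1(1,2)] surj_max_min(2)[OF 1(1,2) 2(1,2)]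
  show "strict_mono (bump c)"
    unfolding bump_def[abs_def] by (rule strict_mono_max_min(1)[OF 1(3) 3(1)])
  moreover have "surj (bump c)"
    unfolding bump_def[abs_def] by (rule surj_max_min(1)[OF 1(3) 3(1) 2(3) 3(2)])
  ultimately show "bij (bump c)"
    by (auto simp: bij_def strict_mono_imp_inj_on)
qed

lemma bump_outside:
  assumes "c > 1" "c \<le> \<bar>x\<bar>" shows "bump c x = x"
proof (cases "x \<ge> 0")
  case True
  \<comment> \<open>To the right of \<open>c\<close> the line of slope at most 1 through
    \<open>(c, c)\<close> lies below the diagonal; to the left of \<open>-c\<close> the steep line
    through \<open>(-c, -c)\<close> does.\<close>
  have "(x - c) / (2 * c - 1) \<le> (x - c) / 1"
    using assms True by (intro divide_left_mono) auto
  then show ?thesis by (simp add: bump_def)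
next
  case False
  have "(2 * c - 2) * (x + c) \<le> 0"
    using assms False by (intro mult_nonneg_nonpos) auto
  then have "(2 * c - 1) * (x + c) - c \<le> x" by (simp add: algebra_simps)
  then show ?thesis by (simp add: bump_def)
qed

lemma bump_displaces:
  assumes "c > 1" "\<bar>x\<bar> < c - 1" shows "bump c x \<ge> c - 1"
proof -
  \<comment> \<open>Both lines pass through the point \<open>(-(c - 1), c - 1)\<close>; monotonicity
    handles the rest of the interval.\<close>
  have "bump c (- (c - 1)) \<ge> c - 1"
    using assms(1) by (simp add: bump_def le_max_iff_disj field_simps)
  moreover have "bump c (- (c - 1)) < bump c x"
    using bump(1)[OF assms(1)] assms(2) by (intro strict_monoD[of "bump c"]) auto
  ultimately show ?thesis by simp
qed

text \<open>The parameter \<open>c = n + 2\<close> exceeds 1 for every \<open>n\<close>; the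
  displaced interval has radius \<open>c - 1 = n + 1\<close>, and the support lies in the next
  interval, of radius \<open>n + 2\<close>.\<close>

interpretation bumps: displacing_bijections "\<lambda>n. bump (of_nat n + 2)" "\<lambda>n. {x. \<bar>x\<bar> < of_nat n + 1}"
proof
  fix n
  show "bij (bump (of_nat n + 2))" by (rule bump(2)) simp
  show "bump (of_nat n + 2) x \<notin> {x. \<bar>x\<bar> < of_nat n + 1}" if "x \<in> {x. \<bar>x\<bar> < of_nat n + 1}" for x
    using bump_displaces[of "of_nat n + 2" x] that by auto
  show "\<exists>m. \<forall>x. x \<notin> {x. \<bar>x\<bar> < of_nat m + 1} \<longrightarrow> bump (of_nat n + 2) x = x"
    by (rule exI[of _ "Suc n"]) (auto intro!: bump_outside)
  show "{x :: rat. \<bar>x\<bar> < of_nat 0 + 1} \<noteq> {}" by (auto intro: exI[of _ 0])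
  fix m assume "m \<le> n"
  then have "(of_nat m :: rat) \<le> of_nat n" by simp
  then show "{x :: rat. \<bar>x\<bar> < of_nat m + 1} \<subseteq> {x. \<bar>x\<bar> < of_nat n + 1}" by auto
qed

text \<open>All generators are strictly increasing, hence so are all elements, and a strictly
  increasing map of finite order is the identity.\<close>

lemma torsion_free_bumps: "torsion_free bumps.D"
  unfolding torsion_free_def
proof (intro ballI allI impI)
  fix f and n :: nat
  assume f: "f \<in> carrier bumps.D" and n: "n > 0" "f [^]\<^bsub>bumps.D\<^esub> n = \<one>\<^bsub>bumps.D\<^esub>"
  have "strict_mono f"
    using f unfolding bumps.D_simps
  proof (induction rule: bumps.S_induct)
    case (inv f)
    then show ?case
      by (metis bij_inv_eq_iff strict_mono_def strict_mono_less)
  qed (auto simp: strict_mono_def intro: strict_monoD[OF bump(1)])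
  moreover have "f ^^ n = id"
    using n(2) by (simp add: bumps.D_def perm.nat_pow_consistent[symmetric] pow_perm_group)
  ultimately show "f = \<one>\<^bsub>bumps.D\<^esub>"
    using strict_mono_funpow_eq_id n(1) by (simp add: bumps.D_simps)
qed

section \<open>The locally finite instance: finitely supported permutations\<close>

text \<open>The involution exchanging the adjacent blocks \<open>{0..n}\<close> and
  \<open>{n+1..2n+1}\<close> in order.\<close>

definition block_swap :: "nat \<Rightarrow> nat \<Rightarrow> nat" where
  "block_swap n x = (if x \<le> n then x + Suc n else if x \<le> 2 * n + 1 then x - Suc n else x)"

interpretation block_swaps: displacing_bijections block_swap "\<lambda>n. {..n}"
proof
  fix n
  have "block_swap n (block_swap n x) = x" for x by (auto simp: block_swap_def)
  then show "bij (block_swap n)" by (intro involuntory_imp_bij)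
  show "\<exists>m. \<forall>x. x \<notin> {..m} \<longrightarrow> block_swap n x = x"
    by (rule exI[of _ "2 * n + 1"]) (auto simp: block_swap_def)
qed (auto simp: block_swap_def)

theorem theorem5p26:
  shows
    "(\<exists>G :: (nat \<Rightarrow> nat) monoid. group G
        \<and> pseudocentre G \<subset> carrier G
        \<and> G\<lparr>carrier := pseudocentre G\<rparr> \<cong> G
        \<and> G Mod pseudocentre G \<cong> G)
     \<and> (\<exists>G :: (nat \<Rightarrow> nat) monoid. group G \<and> torsion_free G
        \<and> pseudocentre G \<subset> carrier G
        \<and> G\<lparr>carrier := pseudocentre G\<rparr> \<cong> G
        \<and> G Mod pseudocentre G \<cong> G)
     \<and> (\<exists>G :: (nat \<Rightarrow> nat) monoid. group G \<and> locally_finite G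
        \<and> pseudocentre G \<subset> carrier G
        \<and> G\<lparr>carrier := pseudocentre G\<rparr> \<cong> G
        \<and> G Mod pseudocentre G \<cong> G)"
  \<comment> \<open>Either instance also witnesses the first existence claim.\<close>
  using bumps.ex_group torsion_free_bumps block_swaps.ex_group block_swaps.locally_finite_D
  by (metis finite_atMost)

end
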